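(* Let $n,s$ be positive integers. Let $\chi_1,\Psi_1$ (for $x>0$), $\chi_2,\Psi_2$ (for $x<0$), the interval $(x_l,x_r)$, the value $h_0$, the arcs $\Gamma_h^+$ ($h\in(0,h_0)$) and the involution $\sigma$ associated with $\Psi_1$ and $\Psi_2$ be as described in the context, and assume that $\sigma'(x)$ is a constant function on $(x_l,x_r)\setminus\{0\}$. Let $f_0,f_1,\dots,f_{n-1}$ be real analytic functions on $(0,x_r)$ such that the line integrals $$I_i(h)=\int_{\Gamma_h^+}f_i(x)\,y^{2s-1}\,dx,\qquad i=0,1,\dots,n-1,$$ converge absolutely for every $h\in(0,h_0)$, and define on $(0,x_r)$ $$l_i(x)=\left(\frac{f_i}{\chi_1^{(2s-1)/2}}\right)(x),\qquad i=0,1,\dots,n-1.$$ If $\{l_0,l_1,\dots,l_{n-1}\}$ is a CT-system on $(0,x_r)$ and $s>n-2$, then $\{I_0,I_1,\dots,I_{n-1}\}$ is an ECT-system on $(0,h_0)$.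
   Context: Setting. Let $x_l<0<x_r$. Consider the piecewise Hamiltonian function $H(x,y)=\chi(x)y^2+\Psi(x)$ given by $H^+(x,y)=\chi_1(x)y^2+\Psi_1(x)$ for $x>0$ and $H^-(x,y)=\chi_2(x)y^2+\Psi_2(x)$ for $x<0$, where $H^{\pm}$ are real analytic on an open subset of the plane (so $\chi_1,\Psi_1$ are analytic on $[0,x_r)$ and $\chi_2,\Psi_2$ are analytic on $(x_l,0]$), $\Psi_1(0)=\Psi_2(0)=0$, $x\Psi_1'(x)>0$ and $\chi_1(x)>0$ for all $x\in(0,x_r)$, $x\Psi_2'(x)>0$ and $\chi_2(x)>0$ for all $x\in(x_l,0)$, and $\lim_{x\to0^+}\chi_1(x)=\lim_{x\to0^-}\chi_2(x)>0$. The interval $(x_l,x_r)$ is the projection onto the $x$-axis of the family of (non-smooth) ovals of $H$ around the origin, and $h_0>0$ is the corresponding limit value of the energy: $\lim_{x\to x_r^-}\Psi_1(x)=\lim_{x\to x_l^+}\Psi_2(x)=h_0$. Arcs. For $h\in(0,h_0)$, $\Gamma_h^+=\{\chi_1(x)y^2+\Psi_1(x)=h,\ 0<x<x_r\}$, oriented clockwise, i.e. running from the positive $y$-axis to the negative $y$-axis in $x>0$. Involution. $\sigma:(x_l,x_r)\to(x_l,x_r)$ is defined by $\sigma(0)=0$; for $x\in(0,x_r)$, $\sigma(x)\in(x_l,0)$ is the unique point with $\Psi_2(\sigma(x))=\Psi_1(x)$; for $x\in(x_l,0)$, $\sigma(x)\in(0,x_r)$ is the unique point with $\Psi_1(\sigma(x))=\Psi_2(x)$.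 It satisfies $\sigma\circ\sigma=\mathrm{Id}$ and is analytic on $(0,x_r)$ and on $(x_l,0)$. Chebyshev systems. Let $g_0,\dots,g_{N-1}$ be real analytic on an open interval $\mathbb I$. The ordered set $\{g_0,\dots,g_{N-1}\}$ is a CT-system (complete Chebyshev system) on $\mathbb I$ if for every $k=1,\dots,N$ every nontrivial linear combination of $g_0,\dots,g_{k-1}$ has at most $k-1$ zeros on $\mathbb I$ (in particular is not identically zero); equivalently, for every $k=1,\dots,N$, $\det(g_j(x_i))_{0\le i,j\le k-1}\neq0$ for all pairwise distinct $x_0,\dots,x_{k-1}\in\mathbb I$. It is an ECT-system (extended complete Chebyshev system) on $\mathbb I$ if for every $k=1,\dots,N$ every nontrivial linear combination of $g_0,\dots,g_{k-1}$ has at most $k-1$ zeros on $\mathbb I$ counted with multiplicity; equivalently, for every $k=1,\dots,N$, the Wronskian $\det(g_j^{(i)}(x))_{0\le i,j\le k-1}\ne0$ for all $x\in\mathbb I$. *)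

theory Defs
  imports "HOL-Analysis.Analysis"
begin

section \<open>Real analytic functions\<close>

text \<open>The power series has to represent \<open>f\<close> only on the part of the neighbourhood inside \<open>S\<close>.
  On an open \<open>S\<close> this is the usual notion. On a half-open interval such as \<open>[0, b)\<close> it says that
  \<open>f\<close> is the restriction of a function that is analytic on a neighbourhood of \<open>S\<close>, and the values
  of \<open>f\<close> outside \<open>S\<close> are irrelevant.\<close>

definition real_analytic_on :: "(real \<Rightarrow> real) \<Rightarrow> real set \<Rightarrow> bool" where
  "real_analytic_on f S \<longleftrightarrow>
     (\<forall>x\<in>S. \<exists>c::nat \<Rightarrow> real. \<exists>r>0. \<forall>y\<in>S. \<bar>y - x\<bar> < r \<longrightarrow> (\<lambda>n. c n * (y - x) ^ n) sums f y)"

section \<open>Chebyshev systems\<close>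

definition CT_system :: "nat \<Rightarrow> (nat \<Rightarrow> real \<Rightarrow> real) \<Rightarrow> real set \<Rightarrow> bool" where
  "CT_system N g S \<longleftrightarrow>
     (\<forall>j<N. real_analytic_on (g j) S) \<and>
     (\<forall>k\<in>{1..N}. \<forall>c::nat \<Rightarrow> real. (\<exists>j<k. c j \<noteq> 0) \<longrightarrow>
        finite {x\<in>S. (\<Sum>j<k. c j * g j x) = 0} \<and>
        card {x\<in>S. (\<Sum>j<k. c j * g j x) = 0} \<le> k - 1)"

text \<open>The multiplicity of \<open>x\<close> as a zero of \<open>F\<close>; it is \<open>\<infinity>\<close> if all derivatives vanish at \<open>x\<close>
  (the infimum of the empty set), and \<open>0\<close> if \<open>F x \<noteq> 0\<close>.\<close>

definition zero_multiplicity :: "(real \<Rightarrow> real) \<Rightarrow> real \<Rightarrow> enat" where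
  "zero_multiplicity F x = (INF m\<in>{m. (deriv ^^ m) F x \<noteq> 0}. enat m)"

definition ECT_system :: "nat \<Rightarrow> (nat \<Rightarrow> real \<Rightarrow> real) \<Rightarrow> real set \<Rightarrow> bool" where
  "ECT_system N g S \<longleftrightarrow>
     (\<forall>j<N. real_analytic_on (g j) S) \<and>
     (\<forall>k\<in>{1..N}. \<forall>c::nat \<Rightarrow> real. (\<exists>j<k. c j \<noteq> 0) \<longrightarrow>
        finite {x\<in>S. (\<Sum>j<k. c j * g j x) = 0} \<and>
        (\<Sum>x | x \<in> S \<and> (\<Sum>j<k. c j * g j x) = 0.
           zero_multiplicity (\<lambda>x. \<Sum>j<k. c j * g j x) x) \<le> enat (k - 1))"

section \<open>Piecewise Hamiltonians\<close>

text \<open>The Hamiltonian is \<open>\<chi>1(x) y\<^sup>2 + \<Psi>1(x)\<close> for \<open>x > 0\<close> and \<open>\<chi>2(x) y\<^sup>2 + \<Psi>2(x)\<close> for \<open>x < 0\<close>.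
  The end points of the projection interval and the limit energy are extended reals, so that
  unbounded families of ovals are covered as well. Since \<open>\<Psi>1\<close> increases from \<open>0\<close> to \<open>h0\<close> and
  \<open>\<Psi>2\<close> decreases from \<open>h0\<close> to \<open>0\<close>, the limit conditions make \<open>(xl, xr)\<close> the projection of the
  family of ovals with energies in \<open>(0, h0)\<close>.\<close>

locale piecewise_hamiltonian =
  fixes \<chi>1 \<Psi>1 \<chi>2 \<Psi>2 :: "real \<Rightarrow> real" and xl xr h0 :: ereal
  assumes xl_neg: "xl < 0" and xr_pos: "0 < xr" and h0_pos: "0 < h0"
    and analytic_right: "real_analytic_on \<chi>1 {x. 0 \<le> x \<and> ereal x < xr}"
                        "real_analytic_on \<Psi>1 {x. 0 \<le> x \<and> ereal x < xr}"
    and analytic_left:  "real_analytic_on \<chi>2 {x. xl < ereal x \<and> x \<le> 0}"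
                        "real_analytic_on \<Psi>2 {x. xl < ereal x \<and> x \<le> 0}"
    and Psi_zero: "\<Psi>1 0 = 0" "\<Psi>2 0 = 0"
    and right_pos: "\<And>x. x \<in> einterval 0 xr \<Longrightarrow> x * deriv \<Psi>1 x > 0 \<and> \<chi>1 x > 0"
    and left_pos:  "\<And>x. x \<in> einterval xl 0 \<Longrightarrow> x * deriv \<Psi>2 x > 0 \<and> \<chi>2 x > 0"
    and chi_limits: "\<exists>c>0. (\<chi>1 \<longlongrightarrow> c) (at_right 0) \<and> (\<chi>2 \<longlongrightarrow> c) (at_left 0)"
    and energy_right: "((ereal \<circ> \<Psi>1 \<circ> real_of_ereal) \<longlongrightarrow> h0) (at_left xr)"
    and energy_left:  "((ereal \<circ> \<Psi>2 \<circ> real_of_ereal) \<longlongrightarrow> h0) (at_right xl)"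

definition involution ::
    "(real \<Rightarrow> real) \<Rightarrow> (real \<Rightarrow> real) \<Rightarrow> ereal \<Rightarrow> ereal \<Rightarrow> real \<Rightarrow> real" where
  "involution \<Psi>1 \<Psi>2 xl xr x =
     (if x = 0 then 0
      else if 0 < x then (THE z. z \<in> einterval xl 0 \<and> \<Psi>2 z = \<Psi>1 x)
      else (THE z. z \<in> einterval 0 xr \<and> \<Psi>1 z = \<Psi>2 x))"

section \<open>Right arcs and line integrals along them\<close>

definition right_arc :: "(real \<Rightarrow> real) \<Rightarrow> (real \<Rightarrow> real) \<Rightarrow> ereal \<Rightarrow> real \<Rightarrow> (real \<times> real) set" where
  "right_arc \<chi>1 \<Psi>1 xr h = {(x, y). x \<in> einterval 0 xr \<and> \<chi>1 x * y\<^sup>2 + \<Psi>1 x = h}"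

text \<open>The abscissa of the point where the arc meets the \<open>x\<close>-axis.\<close>

definition turning_point :: "(real \<Rightarrow> real) \<Rightarrow> ereal \<Rightarrow> real \<Rightarrow> real" where
  "turning_point \<Psi>1 xr h = (THE x. x \<in> einterval 0 xr \<and> \<Psi>1 x = h)"

text \<open>The clockwise parametrisation of the arc by \<open>t \<in> (0, 2a)\<close>, with \<open>a\<close> the turning point:
  along the upper branch with increasing \<open>x = t\<close>, then back along the lower branch with
  decreasing \<open>x = 2a - t\<close>.\<close>

definition right_arc_path ::
    "(real \<Rightarrow> real) \<Rightarrow> (real \<Rightarrow> real) \<Rightarrow> ereal \<Rightarrow> real \<Rightarrow> real \<Rightarrow> real \<times> real" where
  "right_arc_path \<chi>1 \<Psi>1 xr h t =
     (let a = turning_point \<Psi>1 xr h; y = (\<lambda>x. sqrt ((h - \<Psi>1 x) / \<chi>1 x))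
      in if t \<le> a then (t, y t) else (2 * a - t, - y (2 * a - t)))"

text \<open>The line integral \<open>\<integral> P(x, y) dx\<close> along a path parametrised by \<open>T\<close>, as a Lebesgue integral;
  integrability is absolute convergence. The derivative of the first coordinate need only exist
  almost everywhere.\<close>

definition absolutely_convergent_dx ::
    "(real \<Rightarrow> real \<times> real) \<Rightarrow> real set \<Rightarrow> (real \<Rightarrow> real \<Rightarrow> real) \<Rightarrow> bool" where
  "absolutely_convergent_dx \<gamma> T P \<longleftrightarrow>
     set_integrable lborel T (\<lambda>t. P (fst (\<gamma> t)) (snd (\<gamma> t)) * deriv (\<lambda>t. fst (\<gamma> t)) t)"

definition line_integral_dx ::
    "(real \<Rightarrow> real \<times> real) \<Rightarrow> real set \<Rightarrow> (real \<Rightarrow> real \<Rightarrow> real) \<Rightarrow> real" where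
  "line_integral_dx \<gamma> T P =
     (LBINT t:T. P (fst (\<gamma> t)) (snd (\<gamma> t)) * deriv (\<lambda>t. fst (\<gamma> t)) t)"

definition right_arc_convergent ::
    "(real \<Rightarrow> real) \<Rightarrow> (real \<Rightarrow> real) \<Rightarrow> ereal \<Rightarrow> real \<Rightarrow> (real \<Rightarrow> real \<Rightarrow> real) \<Rightarrow> bool" where
  "right_arc_convergent \<chi>1 \<Psi>1 xr h P \<longleftrightarrow>
     absolutely_convergent_dx (right_arc_path \<chi>1 \<Psi>1 xr h) {0<..<2 * turning_point \<Psi>1 xr h} P"

definition right_arc_integral ::
    "(real \<Rightarrow> real) \<Rightarrow> (real \<Rightarrow> real) \<Rightarrow> ereal \<Rightarrow> real \<Rightarrow> (real \<Rightarrow> real \<Rightarrow> real) \<Rightarrow> real" where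
  "right_arc_integral \<chi>1 \<Psi>1 xr h P =
     line_integral_dx (right_arc_path \<chi>1 \<Psi>1 xr h) {0<..<2 * turning_point \<Psi>1 xr h} P"

text \<open>The parametrisation runs through \<open>\<Gamma>\<^sub>h\<^sup>+\<close> exactly once.\<close>

lemma bij_betw_right_arc_path:
  assumes chi: "\<And>x. x \<in> einterval 0 xr \<Longrightarrow> \<chi>1 x > 0"
    and mono: "strict_mono_on (einterval 0 xr) \<Psi>1"
    and a: "a \<in> einterval 0 xr" "\<Psi>1 a = h"
  shows "bij_betw (right_arc_path \<chi>1 \<Psi>1 xr h) {0<..<2 * turning_point \<Psi>1 xr h} (right_arc \<chi>1 \<Psi>1 xr h)"
proof -
  have ta: "turning_point \<Psi>1 xr h = a"
    unfolding turning_point_def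
    using a strict_mono_on_imp_inj_on[OF mono] by (intro the_equality) (auto dest: inj_onD)
  define y where "y x = sqrt ((h - \<Psi>1 x) / \<chi>1 x)" for x
  have path: "right_arc_path \<chi>1 \<Psi>1 xr h t = (if t \<le> a then (t, y t) else (2 * a - t, - y (2 * a - t)))" for t
    unfolding right_arc_path_def ta Let_def y_def by simp
  have inI: "x \<in> einterval 0 xr" if "0 < x" "x \<le> a" for x
    using that a(1) unfolding einterval_def
    by (auto simp: zero_ereal_def intro: le_less_trans[of "ereal x" "ereal a" xr])
  have less: "\<Psi>1 x < h" if "0 < x" "x < a" for x
    using strict_mono_onD[OF mono inI a(1)] that a(2) by auto
  have ypos: "y x > 0" if "0 < x" "x < a" for x
    unfolding y_def using less[OF that] chi[OF inI] that by simp
  have ya: "y a = 0" unfolding y_def using a by simp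
  have ysq: "\<chi>1 x * (y x)\<^sup>2 + \<Psi>1 x = h" if "0 < x" "x \<le> a" for x
  proof -
    have "\<Psi>1 x \<le> h" using less[of x] that a(2) by (cases "x = a") auto
    then show ?thesis
      unfolding y_def using chi[OF inI[OF that]] by (simp add: field_simps)
  qed
  have memb: "right_arc_path \<chi>1 \<Psi>1 xr h t \<in> right_arc \<chi>1 \<Psi>1 xr h" if "0 < t" "t < 2 * a" for t
    using that ysq[of t] ysq[of "2 * a - t"] inI[of t] inI[of "2 * a - t"]
    unfolding path right_arc_def by auto
  have "inj_on (right_arc_path \<chi>1 \<Psi>1 xr h) {0<..<2 * a}"
  proof (rule inj_onI)
    fix s t assume s: "s \<in> {0<..<2 * a}" and t: "t \<in> {0<..<2 * a}"
      and eq: "right_arc_path \<chi>1 \<Psi>1 xr h s = right_arc_path \<chi>1 \<Psi>1 xr h t"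
    have nn: "y u \<ge> 0" if "0 < u" "u \<le> a" for u
      using ypos[of u] ya that by (cases "u = a") auto
    show "s = t"
      using eq s t nn[of s] nn[of t] ypos[of "2 * a - s"] ypos[of "2 * a - t"]
      unfolding path by (auto split: if_splits)
  qed
  moreover have "right_arc \<chi>1 \<Psi>1 xr h \<subseteq> right_arc_path \<chi>1 \<Psi>1 xr h ` {0<..<2 * a}"
  proof clarify
    fix u v assume "(u, v) \<in> right_arc \<chi>1 \<Psi>1 xr h"
    then have u: "u \<in> einterval 0 xr" and e: "\<chi>1 u * v\<^sup>2 + \<Psi>1 u = h"
      by (auto simp: right_arc_def)
    have u0: "0 < u" using u by (auto simp: einterval_def zero_ereal_def)
    have ua: "u \<le> a"
    proof (rule ccontr)
      assume "\<not> u \<le> a"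
      then have "h < \<Psi>1 u" using strict_mono_onD[OF mono a(1) u] a(2) by simp
      moreover have "0 \<le> \<chi>1 u * v\<^sup>2" using chi[OF u] by simp
      ultimately show False using e by linarith
    qed
    have "v\<^sup>2 = (h - \<Psi>1 u) / \<chi>1 u" using e chi[OF u] by (auto simp: field_simps)
    then have yv: "y u = \<bar>v\<bar>" unfolding y_def by (metis real_sqrt_abs)
    show "(u, v) \<in> right_arc_path \<chi>1 \<Psi>1 xr h ` {0<..<2 * a}"
    proof (cases "v \<ge> 0")
      case True
      then have "right_arc_path \<chi>1 \<Psi>1 xr h u = (u, v)" unfolding path using ua yv by simp
      then show ?thesis using u0 ua by (intro image_eqI[of _ _ u]) auto
    next
      case False
      then have "u < a" using ua ya yv by (cases "u = a") auto
      then have "right_arc_path \<chi>1 \<Psi>1 xr h (2 * a - u) = (u, v)"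
        unfolding path using yv False by simp
      then show ?thesis using u0 \<open>u < a\<close> by (intro image_eqI[of _ _ "2 * a - u"]) auto
    qed
  qed
  ultimately show ?thesis
    unfolding bij_betw_def ta using memb by auto
qed

end

theory Submission
  imports Defs "HOL-Complex_Analysis.Complex_Analysis"
begin

text \<open>Substituting \<open>u = \<Psi>1 x\<close> turns \<open>I\<^sub>i\<close> into \<open>I\<^sub>i(h) = 2 \<integral> g\<^sub>i(u) (h - u) powr (s - 1/2) du\<close> over \<open>(0, h)\<close>,
  where the \<open>g\<^sub>i\<close> still form a CT-system. Let \<open>g\<close> be a nontrivial combination of \<open>g\<^sub>0, ..., g\<^sub>k\<^sub>-\<^sub>1\<close>.
  If the corresponding combination of the \<open>I\<^sub>i\<close> had a zero of order \<open>k\<close> at \<open>h\<close>, then \<open>g\<close> would be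
  orthogonal on \<open>(0, h)\<close>, with weight \<open>(h - u) powr (s - k + 1/2)\<close>, to all polynomials of degree
  below \<open>k\<close>; the assumption \<open>s > n - 2\<close> makes this weight integrable. But \<open>g\<close> has at most \<open>k - 1\<close>
  sign changes, so some such polynomial has the sign of \<open>g\<close> everywhere, a contradiction. By the
  division and differentiation argument, the absence of zeros of order \<open>k\<close> for all \<open>k \<le> n\<close>
  yields the ECT-property.\<close>

section \<open>Real analytic functions of one variable\<close>

text \<open>Each differentiation in \<open>h\<close> lowers the exponent of \<open>h - u\<close> by
  one. The derivatives of order below \<open>k\<close> are thus nonzero multiples of integrals of
  \<open>g\<close> against powers with exponents from \<open>s - 1/2\<close> down to
  \<open>s - k + 1/2\<close>, and these powers span the weight times the polynomials of degree below
  \<open>k\<close>. The obstacle is that the last exponent can be \<open>-1/2\<close>, so the kernel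
  blows up at the moving end \<open>u = h\<close>, while near \<open>0\<close> the density is known
  only to be integrable. Differentiation under the integral sign is therefore replaced by
  integration: an Abel integral is a multiple of the integral of the one with exponent lowered by
  one. The fundamental theorem of calculus then needs the latter to be continuous. This, and the
  analyticity demanded of an ECT-system, is obtained by cutting the integral at a fixed point below
  \<open>h\<close>, which separates the two ends. Real analyticity is encoded by a local complex
  extension, so that products, compositions, derivatives and inverse functions are inherited from
  holomorphic functions.\<close>

definition ranalytic_at :: "(real \<Rightarrow> real) \<Rightarrow> real \<Rightarrow> bool" where
  "ranalytic_at f x \<longleftrightarrow>
     (\<exists>F. F analytic_on {complex_of_real x} \<and> (\<forall>\<^sub>F y in nhds x. F (of_real y) = of_real (f y)))"

lemma eventually_nhds_of_real:
  assumes "\<forall>\<^sub>F z in nhds (complex_of_real x). P z"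
  shows "\<forall>\<^sub>F y in nhds x. P (of_real y)"
proof -
  have "filterlim complex_of_real (nhds (of_real x)) (nhds x)"
    by (intro tendsto_of_real filterlim_ident)
  then show ?thesis using assms by (rule eventually_compose_filterlim[rotated])
qed

lemma ranalytic_at_cong:
  assumes "ranalytic_at f x" "\<forall>\<^sub>F y in nhds x. f y = g y"
  shows "ranalytic_at g x"
proof -
  obtain F where "F analytic_on {complex_of_real x}" and F: "\<forall>\<^sub>F y in nhds x. F (of_real y) = of_real (f y)"
    using assms(1) unfolding ranalytic_at_def by blast
  moreover have "\<forall>\<^sub>F y in nhds x. F (of_real y) = of_real (g y)"
    using F assms(2) by eventually_elim simp
  ultimately show ?thesis unfolding ranalytic_at_def by blast
qed

lemma ranalytic_at_const: "ranalytic_at (\<lambda>_. c) x"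
  unfolding ranalytic_at_def by (intro exI[of _ "\<lambda>_. of_real c"]) auto

lemma ranalytic_at_id: "ranalytic_at (\<lambda>y. y) x"
  unfolding ranalytic_at_def by (intro exI[of _ "\<lambda>z. z"]) auto

lemma ranalytic_at_add:
  assumes "ranalytic_at f x" "ranalytic_at g x"
  shows "ranalytic_at (\<lambda>y. f y + g y) x"
proof -
  obtain F G where "F analytic_on {complex_of_real x}" "G analytic_on {complex_of_real x}"
    and FG: "\<forall>\<^sub>F y in nhds x. F (of_real y) = of_real (f y)" "\<forall>\<^sub>F y in nhds x. G (of_real y) = of_real (g y)"
    using assms unfolding ranalytic_at_def by blast
  then have "(\<lambda>z. F z + G z) analytic_on {complex_of_real x}" by (intro analytic_on_add)
  moreover have "\<forall>\<^sub>F y in nhds x. F (of_real y) + G (of_real y) = of_real (f y + g y)"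
    using FG by eventually_elim simp
  ultimately show ?thesis unfolding ranalytic_at_def by (intro exI[of _ "\<lambda>z. F z + G z"]) auto
qed

lemma ranalytic_at_mult:
  assumes "ranalytic_at f x" "ranalytic_at g x"
  shows "ranalytic_at (\<lambda>y. f y * g y) x"
proof -
  obtain F G where "F analytic_on {complex_of_real x}" "G analytic_on {complex_of_real x}"
    and FG: "\<forall>\<^sub>F y in nhds x. F (of_real y) = of_real (f y)" "\<forall>\<^sub>F y in nhds x. G (of_real y) = of_real (g y)"
    using assms unfolding ranalytic_at_def by blast
  then have "(\<lambda>z. F z * G z) analytic_on {complex_of_real x}" by (intro analytic_on_mult)
  moreover have "\<forall>\<^sub>F y in nhds x. F (of_real y) * G (of_real y) = of_real (f y * g y)"
    using FG by eventually_elim simp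
  ultimately show ?thesis unfolding ranalytic_at_def by (intro exI[of _ "\<lambda>z. F z * G z"]) auto
qed

lemma ranalytic_at_diff:
  assumes "ranalytic_at f x" "ranalytic_at g x"
  shows "ranalytic_at (\<lambda>y. f y - g y) x"
  using ranalytic_at_add[OF assms(1) ranalytic_at_mult[OF ranalytic_at_const[of "-1"] assms(2)]] by simp

lemma ranalytic_at_sum:
  assumes "\<And>i. i \<in> A \<Longrightarrow> ranalytic_at (f i) x"
  shows "ranalytic_at (\<lambda>y. \<Sum>i\<in>A. f i y) x"
  using assms by (induction A rule: infinite_finite_induct) (auto intro: ranalytic_at_const ranalytic_at_add)

text \<open>Along the real line the extension \<open>F\<close> has vector derivative
  \<open>deriv F\<close>. Its real part is the derivative of \<open>f\<close>; its imaginary part is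
  the derivative of the zero function. So \<open>deriv F\<close> is real there and extends
  \<open>deriv f\<close>.\<close>

lemma ranalytic_at_imp_deriv:
  assumes "ranalytic_at f x"
  obtains F where "F analytic_on {complex_of_real x}"
    and "\<forall>\<^sub>F y in nhds x. F (of_real y) = of_real (f y)"
    and "\<forall>\<^sub>F y in nhds x. (f has_real_derivative deriv f y) (at y) \<and> deriv F (of_real y) = of_real (deriv f y)"
proof -
  obtain F where F: "F analytic_on {complex_of_real x}" "\<forall>\<^sub>F y in nhds x. F (of_real y) = of_real (f y)"
    using assms unfolding ranalytic_at_def by blast
  obtain s where s: "open s" "complex_of_real x \<in> s" "F holomorphic_on s"
    using F(1) unfolding analytic_at by blast
  have "\<forall>\<^sub>F z in nhds (complex_of_real x). F field_differentiable at z"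
    using s eventually_nhds_in_open[OF s(1,2)] 
    by (auto elim!: eventually_mono simp: holomorphic_on_open field_differentiable_def)
  from eventually_nhds_of_real[OF this]
  have 1: "\<forall>\<^sub>F y in nhds x. F field_differentiable at (of_real y)" .
  have 2: "\<forall>\<^sub>F y in nhds x. \<forall>\<^sub>F w in nhds y. F (of_real w) = of_real (f w)"
    using F(2) by (simp add: eventually_eventually)
  have "\<forall>\<^sub>F y in nhds x. (f has_real_derivative deriv f y) (at y) \<and> deriv F (of_real y) = of_real (deriv f y)"
    using 1 2
  proof eventually_elim
    case (elim y)
    then have "(F has_field_derivative deriv F (of_real y)) (at (of_real y))"
      using field_differentiable_derivI by blast
    then have "((\<lambda>w. F (of_real w)) has_vector_derivative deriv F (of_real y)) (at y)"
      by (rule has_vector_derivative_real_field)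
    then have d: "((\<lambda>w. complex_of_real (f w)) has_vector_derivative deriv F (of_real y)) (at y)"
      by (subst has_vector_derivative_cong_ev[where g = "\<lambda>w. F (of_real w)"])
         (use elim(2) eventually_nhds_x_imp_x[OF elim(2)] in \<open>auto elim: eventually_mono\<close>)
    have re: "(f has_real_derivative Re (deriv F (of_real y))) (at y)"
      using bounded_linear.has_vector_derivative[OF bounded_linear_Re d] by (simp add: has_real_derivative_iff_has_vector_derivative)
    have im: "((\<lambda>w. 0::real) has_real_derivative Im (deriv F (of_real y))) (at y)"
      using bounded_linear.has_vector_derivative[OF bounded_linear_Im d] by (simp add: has_real_derivative_iff_has_vector_derivative)
    then have "Im (deriv F (of_real y)) = 0" using DERIV_unique DERIV_const by blast
    then show ?case using re DERIV_imp_deriv[OF re] by (auto simp: complex_eq_iff)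
  qed
  then show thesis using F that by blast
qed

lemma ranalytic_at_has_deriv:
  assumes "ranalytic_at f x"
  shows "(f has_real_derivative deriv f x) (at x)"
  by (rule ranalytic_at_imp_deriv[OF assms]) (blast dest: eventually_nhds_x_imp_x)

lemma ranalytic_at_deriv:
  assumes "ranalytic_at f x"
  shows "ranalytic_at (deriv f) x"
proof -
  obtain F where "F analytic_on {complex_of_real x}"
    and "\<forall>\<^sub>F y in nhds x. (f has_real_derivative deriv f y) (at y) \<and> deriv F (of_real y) = of_real (deriv f y)"
    using ranalytic_at_imp_deriv[OF assms] by metis
  then show ?thesis unfolding ranalytic_at_def
    by (intro exI[of _ "deriv F"]) (auto intro: analytic_deriv elim: eventually_mono)
qed

lemma ranalytic_at_isCont: "ranalytic_at f x \<Longrightarrow> isCont f x"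
  using ranalytic_at_has_deriv DERIV_isCont by blast

lemma ranalytic_at_compose:
  assumes "ranalytic_at f x" "ranalytic_at k (f x)"
  shows "ranalytic_at (\<lambda>y. k (f y)) x"
proof -
  obtain F K where FK: "F analytic_on {complex_of_real x}" "K analytic_on {complex_of_real (f x)}"
    and ev: "\<forall>\<^sub>F y in nhds x. F (of_real y) = of_real (f y)" "\<forall>\<^sub>F y in nhds (f x). K (of_real y) = of_real (k y)"
    using assms unfolding ranalytic_at_def by blast
  have Fx: "F (of_real x) = of_real (f x)" using ev(1) eventually_nhds_x_imp_x by blast
  have "(K \<circ> F) analytic_on {complex_of_real x}"
    using FK Fx by (intro analytic_on_compose) auto
  moreover have "filterlim f (nhds (f x)) (nhds x)"
    using ranalytic_at_isCont[OF assms(1)] by (simp add: isCont_def tendsto_at_iff_tendsto_nhds)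
  then have "\<forall>\<^sub>F y in nhds x. K (of_real (f y)) = of_real (k (f y))"
    using ev(2) by (rule eventually_compose_filterlim[rotated])
  then have "\<forall>\<^sub>F y in nhds x. (K \<circ> F) (of_real y) = of_real (k (f y))"
    using ev(1) by eventually_elim simp
  ultimately show ?thesis unfolding ranalytic_at_def by blast
qed

lemma ranalytic_at_powr:
  assumes "x > 0"
  shows "ranalytic_at (\<lambda>y. y powr b) x"
  unfolding ranalytic_at_def
proof (intro exI[of _ "\<lambda>z. z powr of_real b"] conjI)
  show "(\<lambda>z. z powr of_real b) analytic_on {complex_of_real x}"
    using assms by (intro analytic_on_powr) auto
  have "\<forall>\<^sub>F y in nhds x. y > 0" using assms by (simp add: eventually_nhds_in_open[of "{0<..}", simplified])
  then show "\<forall>\<^sub>F y in nhds x. complex_of_real y powr of_real b = of_real (y powr b)"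
    by eventually_elim (simp add: powr_of_real)
qed

lemma ranalytic_at_inverse:
  assumes "ranalytic_at f x" "f x \<noteq> 0"
  shows "ranalytic_at (\<lambda>y. inverse (f y)) x"
proof -
  obtain F where F: "F analytic_on {complex_of_real x}" "\<forall>\<^sub>F y in nhds x. F (of_real y) = of_real (f y)"
    using assms unfolding ranalytic_at_def by blast
  have "F (of_real x) = of_real (f x)" using F(2) eventually_nhds_x_imp_x by blast
  then have "(\<lambda>z. inverse (F z)) analytic_on {complex_of_real x}"
    using F(1) assms(2) by (intro analytic_on_inverse) auto
  moreover have "\<forall>\<^sub>F y in nhds x. inverse (F (of_real y)) = of_real (inverse (f y))"
    using F(2) by eventually_elim simp
  ultimately show ?thesis unfolding ranalytic_at_def by (intro exI[of _ "\<lambda>z. inverse (F z)"]) auto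
qed

lemma ranalytic_at_powser:
  assumes "r > 0" "\<And>t. \<bar>t\<bar> < r \<Longrightarrow> summable (\<lambda>n. c n * t ^ n)" "\<bar>x - a\<bar> < r"
  shows "ranalytic_at (\<lambda>y. \<Sum>n. c n * (y - a) ^ n) x"
proof -
  define F where "F z = (\<Sum>n. complex_of_real (c n) * (z - of_real a) ^ n)" for z
  have sm: "summable (\<lambda>n. complex_of_real (c n) * (z - of_real a) ^ n)" if z: "z \<in> ball (of_real a) r" for z
  proof -
    \<comment> \<open>Midpoint between the distance of \<open>z\<close> from the centre and
      \<open>r\<close>: convergence of the real series at \<open>t\<close> forces convergence of the
      complex series at \<open>z\<close>.\<close>
    define t where "t = (r + norm (z - of_real a)) / 2"
    have t: "norm (z - of_real a) < t" "t < r" "t > 0"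
      using z assms(1) by (auto simp: t_def dist_norm norm_minus_commute add_pos_nonneg)
    have "summable (\<lambda>n. c n * t ^ n)" using t by (intro assms) auto
    then have "summable (\<lambda>n. complex_of_real (c n * t ^ n))" by (rule summable_of_real)
    then have "summable (\<lambda>n. complex_of_real (c n) * of_real t ^ n)" by simp
    then show ?thesis by (rule powser_inside) (use t in auto)
  qed
  have "F analytic_on ball (of_real a) r"
    by (rule power_series_analytic[where a = "\<lambda>n. of_real (c n)"]) (auto simp: F_def intro!: summable_sums sm)
  then have "F analytic_on {of_real x}"
    by (rule analytic_on_subset) (use assms(3) in \<open>auto simp: dist_norm norm_minus_commute simp flip: of_real_diff\<close>)
  moreover have "F (of_real y) = of_real (\<Sum>n. c n * (y - a) ^ n)" if "\<bar>y - a\<bar> < r" for y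
    unfolding F_def using suminf_of_real[OF assms(2)[OF that], where 'a = complex] by simp
  moreover have "\<forall>\<^sub>F y in nhds x. y \<in> ball a r"
    by (rule eventually_nhds_in_open) (use assms(3) in \<open>auto simp: dist_real_def\<close>)
  ultimately show ?thesis unfolding ranalytic_at_def
    by (intro exI[of _ F]) (auto elim!: eventually_mono simp: dist_real_def abs_minus_commute)
qed

text \<open>One radius serves all centres near \<open>x\<close>. This permits an expansion about a
  point to the left of \<open>x\<close> that stays valid beyond \<open>x\<close>, as the cut Abel
  integral requires.\<close>

lemma ranalytic_at_nearby_sums:
  assumes "ranalytic_at f x"
  obtains r where "r > 0" "\<And>a. \<bar>a - x\<bar> < r \<Longrightarrow> \<exists>c. \<forall>y. \<bar>y - a\<bar> < 2 * r \<longrightarrow> (\<lambda>n. c n * (y - a) ^ n) sums f y"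
proof -
  obtain F where F: "F analytic_on {complex_of_real x}" "\<forall>\<^sub>F y in nhds x. F (of_real y) = of_real (f y)"
    using assms unfolding ranalytic_at_def by blast
  obtain r1 where r1: "r1 > 0" "F holomorphic_on ball (of_real x) r1"
    using F(1) unfolding analytic_on_def by auto
  obtain r2 where r2: "r2 > 0" "\<And>y. dist y x < r2 \<Longrightarrow> F (of_real y) = of_real (f y)"
    using F(2) unfolding eventually_nhds_metric by blast
  \<comment> \<open>With a third of the radius, \<open>\<bar>a - x\<bar> < r\<close> and
    \<open>\<bar>y - a\<bar> < 2 * r\<close> together keep \<open>y\<close> within
    \<open>3 * r\<close> of \<open>x\<close>, where \<open>F\<close> is holomorphic and extends
    \<open>f\<close>.\<close>
  define r where "r = min r1 r2 / 3"
  have r: "r > 0" "3 * r \<le> r1" "3 * r \<le> r2" using r1 r2 by (auto simp: r_def)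
  have "\<exists>c. \<forall>y. \<bar>y - a\<bar> < 2 * r \<longrightarrow> (\<lambda>n. c n * (y - a) ^ n) sums f y" if a: "\<bar>a - x\<bar> < r" for a
  proof (intro exI allI impI)
    fix y assume y: "\<bar>y - a\<bar> < 2 * r"
    have "ball (complex_of_real a) (2 * r) \<subseteq> ball (of_real x) r1"
    proof
      fix z assume "z \<in> ball (complex_of_real a) (2 * r)"
      moreover have "dist (complex_of_real x) (of_real a) < r"
        using a by (simp add: dist_of_real dist_real_def abs_minus_commute)
      ultimately show "z \<in> ball (of_real x) r1"
        using dist_triangle[of "of_real x" z "of_real a"] r(2) by auto
    qed
    then have "F holomorphic_on ball (of_real a) (2 * r)" using r1(2) holomorphic_on_subset by blast
    moreover have "of_real y \<in> ball (complex_of_real a) (2 * r)"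
      using y by (simp add: dist_of_real dist_real_def abs_minus_commute)
    ultimately have "(\<lambda>n. (deriv ^^ n) F (of_real a) / fact n * (of_real y - of_real a) ^ n) sums F (of_real y)"
      by (rule holomorphic_power_series)
    then have "(\<lambda>n. Re ((deriv ^^ n) F (of_real a) / fact n * of_real ((y - a) ^ n))) sums Re (F (of_real y))"
      by (intro sums_Re) simp
    moreover have "Re (F (of_real y)) = f y" using r2(2)[of y] y a r by (simp add: dist_real_def)
    moreover have "Re (z * of_real t) = Re z * t" for z t by simp
    ultimately show "(\<lambda>n. Re ((deriv ^^ n) F (of_real a) / fact n) * (y - a) ^ n) sums f y" by (simp only:)
  qed
  then show thesis using that r(1) by blast
qed

text \<open>Bridge between the two encodings: complex extensions carry the closure properties, power
  series are what \<open>real_analytic_on\<close> asks for.\<close>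

lemma ranalytic_at_iff_sums:
  "ranalytic_at f x \<longleftrightarrow> (\<exists>c r. r > 0 \<and> (\<forall>y. \<bar>y - x\<bar> < r \<longrightarrow> (\<lambda>n. c n * (y - x) ^ n) sums f y))"
proof
  assume "ranalytic_at f x"
  then obtain r where "r > 0" and
    "\<And>a. \<bar>a - x\<bar> < r \<Longrightarrow> \<exists>c. \<forall>y. \<bar>y - a\<bar> < 2 * r \<longrightarrow> (\<lambda>n. c n * (y - a) ^ n) sums f y"
    using ranalytic_at_nearby_sums by blast
  from this(1) this(2)[of x]
  show "\<exists>c r. r > 0 \<and> (\<forall>y. \<bar>y - x\<bar> < r \<longrightarrow> (\<lambda>n. c n * (y - x) ^ n) sums f y)"
    by (metis abs_zero diff_self mult_pos_pos zero_less_numeral)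
next
  assume "\<exists>c r. r > 0 \<and> (\<forall>y. \<bar>y - x\<bar> < r \<longrightarrow> (\<lambda>n. c n * (y - x) ^ n) sums f y)"
  then obtain c r where r: "r > 0" and c: "\<And>y. \<bar>y - x\<bar> < r \<Longrightarrow> (\<lambda>n. c n * (y - x) ^ n) sums f y" by blast
  have "summable (\<lambda>n. c n * t ^ n)" if "\<bar>t\<bar> < r" for t
    using c[of "x + t"] that by (auto simp: sums_iff)
  then have "ranalytic_at (\<lambda>y. \<Sum>n. c n * (y - x) ^ n) x" using r by (intro ranalytic_at_powser) auto
  moreover have "\<forall>\<^sub>F y in nhds x. (\<Sum>n. c n * (y - x) ^ n) = f y"
    unfolding eventually_nhds_metric using r c by (auto simp: sums_iff dist_real_def)
  ultimately show "ranalytic_at f x" by (rule ranalytic_at_cong)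
qed

lemma real_analytic_on_open_iff:
  assumes "open S"
  shows "real_analytic_on f S \<longleftrightarrow> (\<forall>x\<in>S. ranalytic_at f x)"
proof -
  have "(\<exists>c. \<exists>r>0. \<forall>y\<in>S. \<bar>y - x\<bar> < r \<longrightarrow> (\<lambda>n. c n * (y - x) ^ n) sums f y) \<longleftrightarrow> ranalytic_at f x"
    if x: "x \<in> S" for x
  proof
    assume "\<exists>c. \<exists>r>0. \<forall>y\<in>S. \<bar>y - x\<bar> < r \<longrightarrow> (\<lambda>n. c n * (y - x) ^ n) sums f y"
    then obtain c r where r: "r > 0" and c: "\<And>y. y \<in> S \<Longrightarrow> \<bar>y - x\<bar> < r \<Longrightarrow> (\<lambda>n. c n * (y - x) ^ n) sums f y" by blast
    obtain e where e: "e > 0" "ball x e \<subseteq> S" using assms x open_contains_ball by blast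
    have "(\<lambda>n. c n * (y - x) ^ n) sums f y" if "\<bar>y - x\<bar> < min r e" for y
      using c[of y] e that by (auto simp: subset_iff dist_real_def)
    then show "ranalytic_at f x" unfolding ranalytic_at_iff_sums using r e
      by (intro exI[of _ c] exI[of _ "min r e"]) auto
  qed (unfold ranalytic_at_iff_sums, blast)
  then show ?thesis unfolding real_analytic_on_def by blast
qed

lemma real_analytic_on_interior:
  assumes "real_analytic_on f S" "open U" "U \<subseteq> S" "x \<in> U"
  shows "ranalytic_at f x"
proof -
  have "real_analytic_on f U" using assms(1,3) unfolding real_analytic_on_def by (meson subsetD)
  then show ?thesis using assms real_analytic_on_open_iff by blast
qed

text \<open>Meant for the closed end \<open>0\<close> of a half-open domain, where the series is
  known to represent the function on one side only. Convergence at a single other point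
  \<open>y0\<close> of \<open>S\<close> already gives a positive radius, so the series is continuous
  at \<open>x\<close> from both sides; an isolated \<open>x\<close> needs no argument.\<close>

lemma real_analytic_on_continuous_on:
  assumes "real_analytic_on f S"
  shows "continuous_on S f"
  unfolding continuous_on_def
proof
  fix x assume x: "x \<in> S"
  obtain c r where r: "r > 0" and c: "\<And>y. y \<in> S \<Longrightarrow> \<bar>y - x\<bar> < r \<Longrightarrow> (\<lambda>n. c n * (y - x) ^ n) sums f y"
    using assms x unfolding real_analytic_on_def by blast
  show "(f \<longlongrightarrow> f x) (at x within S)"
  proof (cases "at x within S = bot")
    case False
    then have "x islimpt S" by (simp add: trivial_limit_within)
    then obtain y0 where y0: "y0 \<in> S" "y0 \<noteq> x" "dist y0 x < r" using r unfolding islimpt_approachable by blast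
    define \<rho> where "\<rho> = \<bar>y0 - x\<bar>"
    have \<rho>: "\<rho> > 0" using y0 by (simp add: \<rho>_def)
    have "summable (\<lambda>n. c n * (y0 - x) ^ n)" using c[of y0] y0 by (auto simp: sums_iff dist_real_def)
    then have "summable (\<lambda>n. c n * t ^ n)" if "\<bar>t\<bar> < \<rho>" for t
      by (rule powser_inside) (use that in \<open>auto simp: \<rho>_def\<close>)
    then have "ranalytic_at (\<lambda>y. \<Sum>n. c n * (y - x) ^ n) x" using \<rho> by (intro ranalytic_at_powser) auto
    then have "((\<lambda>y. \<Sum>n. c n * (y - x) ^ n) \<longlongrightarrow> (\<Sum>n. c n * (x - x) ^ n)) (at x within S)"
      using ranalytic_at_isCont continuous_at_imp_continuous_at_within continuous_within by blast
    moreover have "(\<Sum>n. c n * (x - x) ^ n) = f x" using c[of x] x r by (auto simp: sums_iff)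
    moreover have "\<forall>\<^sub>F y in at x within S. (\<Sum>n. c n * (y - x) ^ n) = f y"
      unfolding eventually_at using r c by (auto simp: sums_iff dist_real_def)
    ultimately show ?thesis by (simp add: tendsto_cong)
  qed simp
qed

lemma eventually_ranalytic_at:
  assumes "ranalytic_at f x"
  shows "\<forall>\<^sub>F y in nhds x. ranalytic_at f y"
proof -
  obtain F where F: "F analytic_on {complex_of_real x}" "\<forall>\<^sub>F y in nhds x. F (of_real y) = of_real (f y)"
    using assms unfolding ranalytic_at_def by blast
  obtain s where s: "open s" "complex_of_real x \<in> s" "F holomorphic_on s"
    using F(1) unfolding analytic_at by blast
  have "\<forall>\<^sub>F y in nhds x. F analytic_on {complex_of_real y}"
    using eventually_nhds_of_real[OF eventually_nhds_in_open[OF s(1,2)]]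
    by eventually_elim (use s in \<open>auto simp: analytic_at\<close>)
  moreover have "\<forall>\<^sub>F y in nhds x. \<forall>\<^sub>F w in nhds y. F (of_real w) = of_real (f w)"
    using F(2) by (simp add: eventually_eventually)
  ultimately show ?thesis unfolding ranalytic_at_def by eventually_elim blast
qed

text \<open>A nonzero derivative makes the extension \<open>F\<close> injective near
  \<open>x\<close>, with holomorphic inverse \<open>G\<close>. A priori \<open>G\<close> and
  \<open>g\<close> agree only at values of \<open>f\<close>; these fill a neighbourhood of
  \<open>f x\<close> because \<open>f\<close>, having the left inverse \<open>g\<close>, is
  injective near \<open>x\<close> and so an open map there.\<close>

lemma ranalytic_at_inverse_function:
  assumes f: "ranalytic_at f x" "deriv f x \<noteq> 0"
    and inv: "\<forall>\<^sub>F y in nhds x. g (f y) = y"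
  shows "ranalytic_at g (f x)"
proof -
  obtain F where F: "F analytic_on {complex_of_real x}"
    and Ff: "\<forall>\<^sub>F y in nhds x. F (of_real y) = of_real (f y)"
    and F': "\<forall>\<^sub>F y in nhds x. (f has_real_derivative deriv f y) (at y) \<and> deriv F (of_real y) = of_real (deriv f y)"
    by (rule ranalytic_at_imp_deriv[OF f(1)])
  have Fx: "F (of_real x) = of_real (f x)" and dF: "deriv F (of_real x) \<noteq> 0"
    using eventually_nhds_x_imp_x[OF Ff] eventually_nhds_x_imp_x[OF F'] f(2) by auto
  obtain s where s: "open s" "complex_of_real x \<in> s" "F holomorphic_on s"
    using F unfolding analytic_at by blast
  obtain r where r: "r > 0" "ball (of_real x) r \<subseteq> s" "inj_on F (ball (of_real x) r)"
    using has_complex_derivative_locally_injective[OF s(3,2,1) dF] by metis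
  let ?B = "ball (complex_of_real x) r"
  have hB: "F holomorphic_on ?B" using s(3) r(2) holomorphic_on_subset by blast
  obtain G where G: "G holomorphic_on F ` ?B" "\<And>z. z \<in> ?B \<Longrightarrow> G (F z) = z"
    using holomorphic_has_inverse[OF hB _ r(3)] by (metis open_ball)
  have oF: "open (F ` ?B)" using open_mapping_thm3[OF hB _ r(3)] by simp
  have "G analytic_on {of_real (f x)}"
    unfolding analytic_at using G(1) oF r(1) Fx by (metis centre_in_ball imageI)
  moreover have "\<forall>\<^sub>F v in nhds (f x). G (of_real v) = of_real (g v)"
  proof -
    have "\<forall>\<^sub>F y in nhds x. complex_of_real y \<in> ?B"
      by (intro eventually_nhds_of_real eventually_nhds_in_open) (use r in auto)
    then have "\<forall>\<^sub>F y in nhds x. G (of_real (f y)) = of_real (g (f y)) 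
        \<and> (f has_real_derivative deriv f y) (at y)"
      using Ff inv F' by eventually_elim (use G(2) in metis)
    then obtain e where e: "e > 0" "\<And>y. dist y x < e \<Longrightarrow> G (of_real (f y)) = of_real (g (f y))"
      "\<And>y. dist y x < e \<Longrightarrow> (f has_real_derivative deriv f y) (at y)"
      unfolding eventually_nhds_metric by blast
    have "\<forall>\<^sub>F v in nhds (f x). v \<in> f ` ball x e"
    proof -
      have "\<forall>\<^sub>F z in nhds x. z \<in> ball x e \<and> g (f z) = z" using inv eventually_nhds_in_open[of "ball x e" x] e(1)
        by (auto intro: eventually_conj)
      then obtain e' where e': "e' > 0" "\<And>y. dist y x < e' \<Longrightarrow> y \<in> ball x e \<and> g (f y) = y"
        unfolding eventually_nhds_metric by blast
      have "inj_on f (ball x e')" by (rule inj_on_inverseI[of _ g]) (use e' in \<open>auto simp: dist_commute\<close>)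
      moreover have "continuous_on (ball x e') f"
      proof (rule continuous_at_imp_continuous_on, rule ballI)
        fix y assume "y \<in> ball x e'"
        then have "dist y x < e" using e'(2)[of y] by (simp add: dist_commute)
        then show "isCont f y" using e(3) DERIV_isCont by blast
      qed
      ultimately have "open (f ` ball x e')"
        using injective_eq_1d_open_map_UNIV invariance_of_domain by blast
      then have "\<forall>\<^sub>F v in nhds (f x). v \<in> f ` ball x e'"
        by (rule eventually_nhds_in_open) (use e'(1) in auto)
      then show ?thesis by eventually_elim (use e'(2) in \<open>auto simp: dist_commute\<close>)
    qed
    then show ?thesis by eventually_elim (use e(2) in \<open>auto simp: dist_commute\<close>)
  qed
  ultimately show ?thesis unfolding ranalytic_at_def by blast
qed

section \<open>Counting zeros with multiplicity\<close>

text \<open>A lower bound for the order of a zero, not the exact order. It makes sense also when all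
  derivatives vanish, and it passes to sums and products.\<close>

definition vanishes :: "(real \<Rightarrow> real) \<Rightarrow> real \<Rightarrow> nat \<Rightarrow> bool" where
  "vanishes F a m \<longleftrightarrow> (\<forall>i<m. (deriv ^^ i) F a = 0)"

lemma vanishes_0 [simp]: "vanishes F a 0"
  by (simp add: vanishes_def)

lemma vanishes_Suc: "vanishes F a (Suc m) \<longleftrightarrow> F a = 0 \<and> vanishes (deriv F) a m"
  unfolding vanishes_def All_less_Suc2 funpow_Suc_right by simp

lemma vanishes_le: "vanishes F a m \<Longrightarrow> k \<le> m \<Longrightarrow> vanishes F a k"
  by (simp add: vanishes_def)

lemma vanishes_cong:
  assumes "\<forall>\<^sub>F y in nhds a. F y = G y" "vanishes F a m"
  shows "vanishes G a m"
  using assms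
proof (induction m arbitrary: F G)
  case (Suc m)
  have "\<forall>\<^sub>F y in nhds a. \<forall>\<^sub>F w in nhds y. F w = G w"
    using Suc.prems(1) by (simp add: eventually_eventually)
  then have "\<forall>\<^sub>F y in nhds a. deriv F y = deriv G y"
    by eventually_elim (rule deriv_cong_ev, auto)
  then have "vanishes (deriv G) a m" by (rule Suc.IH) (use Suc.prems(2) in \<open>simp add: vanishes_Suc\<close>)
  then show ?case using Suc.prems(2) eventually_nhds_x_imp_x[OF Suc.prems(1)] by (simp add: vanishes_Suc)
qed simp

lemma vanishes_add:
  assumes "ranalytic_at F a" "ranalytic_at G a" "vanishes F a m" "vanishes G a m"
  shows "vanishes (\<lambda>y. F y + G y) a m"
  using assms
proof (induction m arbitrary: F G)
  case (Suc m)
  have "\<forall>\<^sub>F y in nhds a. deriv F y + deriv G y = deriv (\<lambda>y. F y + G y) y"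
    using eventually_ranalytic_at[OF Suc.prems(1)] eventually_ranalytic_at[OF Suc.prems(2)]
    by eventually_elim (intro DERIV_imp_deriv[symmetric] DERIV_add ranalytic_at_has_deriv)
  moreover have "vanishes (\<lambda>y. deriv F y + deriv G y) a m"
    using Suc.prems by (intro Suc.IH ranalytic_at_deriv) (auto simp: vanishes_Suc)
  ultimately have "vanishes (deriv (\<lambda>y. F y + G y)) a m" by (rule vanishes_cong)
  then show ?case using Suc.prems(3-) by (simp add: vanishes_Suc)
qed simp

text \<open>Leibniz rule by induction: in \<open>F' * G + F * G'\<close> the first factor of each
  summand vanishes to order \<open>m\<close>. Only the order of one factor enters, so multiplying by
  the inverse of a nonvanishing function preserves it.\<close>

lemma vanishes_mult:
  assumes "ranalytic_at F a" "ranalytic_at G a" "vanishes F a m"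
  shows "vanishes (\<lambda>y. F y * G y) a m"
  using assms
proof (induction m arbitrary: F G)
  case (Suc m)
  have "\<forall>\<^sub>F y in nhds a. deriv F y * G y + F y * deriv G y = deriv (\<lambda>y. F y * G y) y"
    using eventually_ranalytic_at[OF Suc.prems(1)] eventually_ranalytic_at[OF Suc.prems(2)]
  proof eventually_elim
    case (elim y)
    then have "((\<lambda>y. F y * G y) has_real_derivative deriv F y * G y + deriv G y * F y) (at y)"
      by (intro DERIV_mult ranalytic_at_has_deriv)
    then show ?case by (metis DERIV_imp_deriv mult.commute)
  qed
  moreover have "vanishes (\<lambda>y. deriv F y * G y) a m" "vanishes (\<lambda>y. F y * deriv G y) a m"
    using Suc.prems vanishes_le[OF Suc.prems(3), of m] by (intro Suc.IH ranalytic_at_deriv; simp add: vanishes_Suc)+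
  then have "vanishes (\<lambda>y. deriv F y * G y + F y * deriv G y) a m"
    using Suc.prems by (intro vanishes_add ranalytic_at_mult ranalytic_at_deriv)
  ultimately have "vanishes (deriv (\<lambda>y. F y * G y)) a m" by (rule vanishes_cong)
  then show ?case using Suc.prems(3-) by (simp add: vanishes_Suc)
qed simp

text \<open>Bounds the number of zeros counted with multiplicity by testing finite sets of points
  with prescribed lower bounds on the orders. Neither the zero set nor the orders have to be known
  finite beforehand; both follow from the bound.\<close>

definition zeros_bounded :: "(real \<Rightarrow> real) \<Rightarrow> real set \<Rightarrow> nat \<Rightarrow> bool" where
  "zeros_bounded F S m \<longleftrightarrow>
     (\<forall>A \<mu>. finite A \<longrightarrow> A \<subseteq> S \<longrightarrow> (\<forall>a\<in>A. vanishes F a (\<mu> a)) \<longrightarrow> (\<Sum>a\<in>A. \<mu> a) \<le> m)"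

text \<open>Induction over the zeros in increasing order: each new largest zero adds one critical
  point strictly between it and its predecessor. Disjointness from \<open>A\<close> allows these
  points to be counted in addition to multiple zeros of \<open>F\<close>.\<close>

lemma Rolle_zeros:
  assumes "is_interval S" "\<And>x. x \<in> S \<Longrightarrow> ranalytic_at F x"
    and "finite A" "A \<noteq> {}" "A \<subseteq> S" "\<And>a. a \<in> A \<Longrightarrow> F a = 0"
  shows "\<exists>B. finite B \<and> card B = card A - 1 \<and> A \<inter> B = {} \<and> B \<subseteq> {Min A<..<Max A} \<and> (\<forall>b\<in>B. deriv F b = 0)"
  using assms(3-6)
proof (induction A rule: finite_linorder_max_induct)
  case (insert b A)
  show ?case
  proof (cases "A = {}")
    case True
    then show ?thesis by (intro exI[of _ "{}"]) auto
  next
    case False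
    moreover have "A \<subseteq> S" "\<And>a. a \<in> A \<Longrightarrow> F a = 0" using insert.prems by auto
    ultimately obtain B where B: "finite B" "card B = card A - 1" "A \<inter> B = {}" "B \<subseteq> {Min A<..<Max A}" "\<forall>b\<in>B. deriv F b = 0"
      using insert.IH by metis
    define M where "M = Max A"
    have M: "M \<in> A" "M < b" using insert.hyps False by (auto simp: M_def)
    have "M \<in> S" "b \<in> S" using insert.prems(2) M by auto
    then have sub: "{M..b} \<subseteq> S"
      using assms(1) unfolding is_interval_1 by (metis atLeastAtMost_iff subsetI)
    have "\<exists>z. M < z \<and> z < b \<and> deriv F z = 0"
    proof -
      have "\<exists>z>M. z < b \<and> DERIV F z :> 0"
      proof (rule Rolle[OF M(2)])
        show "F M = F b" using insert.prems(3) M(1) by simp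
        show "continuous_on {M..b} F"
          by (intro continuous_at_imp_continuous_on ballI ranalytic_at_isCont assms(2)) (use sub in auto)
        show "F differentiable (at x)" if "M < x" "x < b" for x
        proof -
          have "x \<in> S" using that sub by auto
          then show ?thesis using ranalytic_at_has_deriv[OF assms(2)] real_differentiable_def by blast
        qed
      qed
      then show ?thesis using DERIV_imp_deriv by blast
    qed
    then obtain z where z: "M < z" "z < b" "deriv F z = 0" by blast
    have lt: "x < M" if "x \<in> B" for x using B(4) that by (auto simp: M_def)
    have le: "x \<le> M" if "x \<in> A" for x using insert.hyps(1) that by (simp add: M_def)
    have zB: "z \<notin> B" "z \<notin> A" "b \<notin> B" using lt[of z] le[of z] lt[of b] z M by auto
    have "Min A \<le> M" using M(1) insert.hyps(1) by simp
    have Mx: "Max (insert b A) = b" "Min (insert b A) = Min A"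
      using insert.hyps(1) False M(2) \<open>Min A \<le> M\<close> by (simp_all add: Max_insert Min_insert flip: M_def)
    show ?thesis
    proof (intro exI[of _ "insert z B"] conjI)
      show "card (insert z B) = card (insert b A) - 1"
        using B zB insert.hyps False by (auto simp: card_gt_0_iff)
      show "insert z B \<subseteq> {Min (insert b A)<..<Max (insert b A)}"
        unfolding Mx using z B(4) M(2) \<open>Min A \<le> M\<close> by (auto simp: M_def)
    qed (use B z zB insert.hyps in auto)
  qed
qed simp

text \<open>A zero of order \<open>\<mu> a\<close> leaves one of order \<open>\<mu> a - 1\<close>
  for the derivative, and Rolle supplies one more in each gap. Over \<open>card A'\<close> zeros the
  total order thus drops by at most one.\<close>

lemma zeros_bounded_Rolle:
  assumes S: "is_interval S" and an: "\<And>x. x \<in> S \<Longrightarrow> ranalytic_at F x" and zb: "zeros_bounded (deriv F) S m"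
  shows "zeros_bounded F S (Suc m)"
  unfolding zeros_bounded_def
proof (intro allI impI)
  fix A \<mu> assume A: "finite A" "A \<subseteq> S" and van: "\<forall>a\<in>A. vanishes F a (\<mu> a)"
  \<comment> \<open>Points with prescribed order \<open>0\<close> need not be zeros, and the
    truncated difference \<open>\<mu> a - 1\<close> would miscount them.\<close>
  define A' where "A' = {a\<in>A. \<mu> a > 0}"
  have A': "finite A'" "A' \<subseteq> S" using A by (auto simp: A'_def)
  have van': "F a = 0 \<and> vanishes (deriv F) a (\<mu> a - 1)" if "a \<in> A'" for a
    using van that vanishes_Suc[of F a "\<mu> a - 1"] by (auto simp: A'_def)
  have sumA: "(\<Sum>a\<in>A. \<mu> a) = (\<Sum>a\<in>A'. \<mu> a)"
    using A(1) by (intro sum.mono_neutral_right) (auto simp: A'_def)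
  show "(\<Sum>a\<in>A. \<mu> a) \<le> Suc m"
  proof (cases "A' = {}")
    case False
    obtain B where B: "finite B" "card B = card A' - 1" "A' \<inter> B = {}" "B \<subseteq> {Min A'<..<Max A'}" "\<forall>b\<in>B. deriv F b = 0"
      using Rolle_zeros[OF S an A'(1) False A'(2)] van' by blast
    have "B \<subseteq> S"
    proof
      fix b assume "b \<in> B"
      then have "Min A' \<le> b" "b \<le> Max A'" using B(4) by auto
      moreover have "Min A' \<in> S" "Max A' \<in> S" using A' False subsetD[OF A'(2) Min_in] subsetD[OF A'(2) Max_in] by blast+
      ultimately show "b \<in> S" using S unfolding is_interval_1 by blast
    qed
    define \<nu> where "\<nu> x = (if x \<in> A' then \<mu> x - 1 else 1)" for x
    have "(\<Sum>x\<in>A' \<union> B. \<nu> x) \<le> m"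
    proof (rule zb[unfolded zeros_bounded_def, rule_format])
      show "vanishes (deriv F) a (\<nu> a)" if "a \<in> A' \<union> B" for a
        using that van' B(5) by (auto simp: \<nu>_def vanishes_def)
    qed (use A' \<open>B \<subseteq> S\<close> B(1) in auto)
    moreover have "(\<Sum>x\<in>A' \<union> B. \<nu> x) = (\<Sum>x\<in>A'. \<mu> x - 1) + card B"
    proof -
      have "(\<Sum>x\<in>A'. \<nu> x) = (\<Sum>x\<in>A'. \<mu> x - 1)" by (rule sum.cong) (auto simp: \<nu>_def)
      moreover have "(\<Sum>x\<in>B. \<nu> x) = (\<Sum>x\<in>B. 1)" by (rule sum.cong) (use B(3) in \<open>auto simp: \<nu>_def\<close>)
      ultimately show ?thesis using sum.union_disjoint[OF A'(1) B(1,3), of \<nu>] by simp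
    qed
    moreover have "(\<Sum>x\<in>A'. \<mu> x) = (\<Sum>x\<in>A'. (\<mu> x - 1) + 1)"
      by (rule sum.cong) (auto simp: A'_def)
    then have "(\<Sum>x\<in>A'. \<mu> x) = (\<Sum>x\<in>A'. \<mu> x - 1) + card A'" unfolding sum.distrib by simp
    ultimately show ?thesis using B(2) sumA by linarith
  qed (use sumA in simp)
qed

text \<open>This replaces the nonvanishing Wronskians: the property that no nontrivial combination of the
  first \<open>m\<close> functions vanishes to order \<open>m\<close> survives division by \<open>g 0\<close> followed by differentiation.\<close>

lemma zeros_bounded_if_no_high_order_zero:
  assumes S: "is_interval S" "open S"
    and an: "\<And>j x. j < k \<Longrightarrow> x \<in> S \<Longrightarrow> ranalytic_at (g j) x"
    and no: "\<And>m c x. m \<in> {1..k} \<Longrightarrow> \<exists>j<m. c j \<noteq> 0 \<Longrightarrow> x \<in> S \<Longrightarrow> \<not> vanishes (\<lambda>x. \<Sum>j<m. c j * g j x) x m"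
    and nz: "\<exists>j<k. c j \<noteq> 0"
  shows "zeros_bounded (\<lambda>x. \<Sum>j<k. c j * g j x) S (k - 1)"
  using an no nz
proof (induction k arbitrary: g c)
  case (Suc k)
  let ?F = "\<lambda>x. \<Sum>j<Suc k. c j * g j x"
  have g0: "g 0 x \<noteq> 0" if "x \<in> S" for x
  proof -
    \<comment> \<open>The hypothesis for \<open>m = 1\<close> says exactly that \<open>g 0\<close>
      has no zeros, so division by it is legitimate.\<close>
    have "\<not> vanishes (\<lambda>x. \<Sum>j<1. 1 * g j x) x 1"
      by (rule Suc.prems(2)) (use that in auto)
    then show ?thesis by (simp add: vanishes_def)
  qed
  define q where "q j x = g (Suc j) x * inverse (g 0 x)" for j x
  have qan: "ranalytic_at (q j) x" if "j < k" "x \<in> S" for j x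
    unfolding q_def using that g0 Suc.prems(1)
    by (intro ranalytic_at_mult ranalytic_at_inverse) auto
  have comb_an: "ranalytic_at (\<lambda>x. (\<Sum>j<m. d j * q j x) + b) x" if "m \<le> k" "x \<in> S" for m d x b
    using that by (intro ranalytic_at_add ranalytic_at_sum ranalytic_at_mult ranalytic_at_const qan) auto
  have comb_deriv: "deriv (\<lambda>x. (\<Sum>j<m. d j * q j x) + b) x = (\<Sum>j<m. d j * deriv (q j) x)"
    if "m \<le> k" "x \<in> S" for m d x b
    using that by (intro DERIV_imp_deriv) (auto intro!: derivative_eq_intros ranalytic_at_has_deriv qan sum.cong)
  have comb_mult: "((\<Sum>j<m. d j * q j x) + b) * g 0 x = (\<Sum>j<Suc m. (case j of 0 \<Rightarrow> b | Suc i \<Rightarrow> d i) * g j x)"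
    if "x \<in> S" for m d x b
  proof -
    have "d j * q j x * g 0 x = d j * g (Suc j) x" for j
      using g0[OF that] by (simp add: q_def)
    then show ?thesis unfolding sum.lessThan_Suc_shift
      by (simp only: distrib_right sum_distrib_right nat.case add.commute)
  qed
  have evS: "\<forall>\<^sub>F y in nhds x. y \<in> S" if "x \<in> S" for x
    using S(2) that by (rule eventually_nhds_in_open)
  have vanF: "vanishes ?F x m \<Longrightarrow> vanishes (\<lambda>x. (\<Sum>j<k. c (Suc j) * q j x) + c 0) x m" if x: "x \<in> S" for x m
  proof -
    assume v: "vanishes ?F x m"
    have "vanishes (\<lambda>y. ?F y * inverse (g 0 y)) x m"
      using x g0 Suc.prems(1) v
      by (intro vanishes_mult ranalytic_at_sum ranalytic_at_mult ranalytic_at_const ranalytic_at_inverse) auto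
    moreover have "\<forall>\<^sub>F y in nhds x. ?F y * inverse (g 0 y) = (\<Sum>j<k. c (Suc j) * q j y) + c 0"
      using evS[OF x]
    proof eventually_elim
      case (elim y)
      have "((\<Sum>j<k. c (Suc j) * q j y) + c 0) * g 0 y = ?F y"
        unfolding comb_mult[OF elim] by (intro sum.cong) (auto split: nat.split)
      moreover have "A * G = B \<Longrightarrow> G \<noteq> 0 \<Longrightarrow> B * inverse G = A" for A B G :: real
        by (auto simp: field_simps)
      ultimately show ?case using g0[OF elim] by blast
    qed
    ultimately show ?thesis by (rule vanishes_cong[rotated])
  qed
  have reduce: "zeros_bounded (\<lambda>x. (\<Sum>j<k. c (Suc j) * q j x) + c 0) S k"
  proof (cases "\<exists>j<k. c (Suc j) \<noteq> 0")
    case False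
    \<comment> \<open>Only the multiple of \<open>g 0\<close> is left; after division it is a
      nonzero constant, which has no zeros at all.\<close>
    then have c0: "c 0 \<noteq> 0" using Suc.prems(3) by (metis less_Suc_eq_0_disj)
    have eq: "(\<lambda>x. (\<Sum>j<k. c (Suc j) * q j x) + c 0) = (\<lambda>x. c 0)"
      using False by (intro ext) simp
    have "m = 0" if "vanishes (\<lambda>_. c 0) a m" for a m
      using that c0 by (cases m) (auto simp: vanishes_Suc)
    then show ?thesis unfolding zeros_bounded_def eq by (metis le0 sum.neutral)
  next
    case True
    have "zeros_bounded (\<lambda>x. \<Sum>j<k. c (Suc j) * deriv (q j) x) S (k - 1)"
    proof (rule Suc.IH[of "\<lambda>j. deriv (q j)" "\<lambda>j. c (Suc j)"])
      show "ranalytic_at (deriv (q j)) x" if "j < k" "x \<in> S" for j x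
        using that by (intro ranalytic_at_deriv qan)
      show "\<not> vanishes (\<lambda>x. \<Sum>j<m. d j * deriv (q j) x) x m"
        if m: "m \<in> {1..k}" and d: "\<exists>j<m. d j \<noteq> 0" and x: "x \<in> S" for m d x
      proof
        assume v: "vanishes (\<lambda>x. \<Sum>j<m. d j * deriv (q j) x) x m"
        \<comment> \<open>The constant of integration is chosen so that the combination of quotients
          itself vanishes at \<open>x\<close>. This raises its order from \<open>m\<close> to
          \<open>Suc m\<close>; after multiplication by \<open>g 0\<close>, \<open>b\<close> becomes
          the coefficient of \<open>g 0\<close>.\<close>
        define b where "b = - (\<Sum>j<m. d j * q j x)"
        let ?E = "\<lambda>x. (\<Sum>j<m. d j * q j x) + b"
        have "\<forall>\<^sub>F y in nhds x. (\<Sum>j<m. d j * deriv (q j) y) = deriv ?E y"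
          using evS[OF x] by eventually_elim (use m in \<open>simp add: comb_deriv\<close>)
        then have "vanishes (deriv ?E) x m" using v by (rule vanishes_cong)
        then have "vanishes ?E x (Suc m)" by (simp add: vanishes_Suc b_def)
        then have "vanishes (\<lambda>y. ?E y * g 0 y) x (Suc m)"
          using m x Suc.prems(1) by (intro vanishes_mult comb_an) auto
        moreover have "\<forall>\<^sub>F y in nhds x. ?E y * g 0 y = (\<Sum>j<Suc m. (case j of 0 \<Rightarrow> b | Suc i \<Rightarrow> d i) * g j y)"
          using evS[OF x] by eventually_elim (rule comb_mult)
        ultimately have "vanishes (\<lambda>y. \<Sum>j<Suc m. (case j of 0 \<Rightarrow> b | Suc i \<Rightarrow> d i) * g j y) x (Suc m)"
          by (rule vanishes_cong[rotated])
        moreover have "\<exists>j<Suc m. (case j of 0 \<Rightarrow> b | Suc i \<Rightarrow> d i) \<noteq> 0" using d by force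
        ultimately show False using Suc.prems(2)[of "Suc m"] m x by auto
      qed
      show "\<exists>j<k. c (Suc j) \<noteq> 0" by fact
    qed
    moreover have "zeros_bounded (deriv (\<lambda>x. (\<Sum>j<k. c (Suc j) * q j x) + c 0)) S (k - 1)"
      if z: "zeros_bounded (\<lambda>x. \<Sum>j<k. c (Suc j) * deriv (q j) x) S (k - 1)"
      unfolding zeros_bounded_def
    proof (intro allI impI)
      fix A \<mu> assume A: "finite A" "A \<subseteq> S"
        and v: "\<forall>a\<in>A. vanishes (deriv (\<lambda>x. (\<Sum>j<k. c (Suc j) * q j x) + c 0)) a (\<mu> a)"
      have "vanishes (\<lambda>x. \<Sum>j<k. c (Suc j) * deriv (q j) x) a (\<mu> a)" if "a \<in> A" for a
      proof (rule vanishes_cong)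
        show "vanishes (deriv (\<lambda>x. (\<Sum>j<k. c (Suc j) * q j x) + c 0)) a (\<mu> a)" using v that by blast
        show "\<forall>\<^sub>F y in nhds a. deriv (\<lambda>x. (\<Sum>j<k. c (Suc j) * q j x) + c 0) y = (\<Sum>j<k. c (Suc j) * deriv (q j) y)"
          by (rule eventually_mono[OF evS]) (use that A in \<open>auto simp: comb_deriv\<close>)
      qed
      then show "(\<Sum>a\<in>A. \<mu> a) \<le> k - 1" using z A unfolding zeros_bounded_def by blast
    qed
    ultimately have "zeros_bounded (\<lambda>x. (\<Sum>j<k. c (Suc j) * q j x) + c 0) S (Suc (k - 1))"
      by (intro zeros_bounded_Rolle[OF S(1)] comb_an) auto
    then show ?thesis using True by (metis One_nat_def Suc_pred gr_implies_not_zero neq0_conv)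
  qed
  then show ?case unfolding zeros_bounded_def using vanF by (auto simp: subset_iff)
qed simp

text \<open>Testing with order \<open>1\<close> everywhere bounds the number of zeros. Testing a
  single point with order \<open>Suc m\<close> excludes infinite multiplicity, so the exact orders
  may be used as weights.\<close>

lemma zeros_bounded_imp_zero_multiplicity:
  assumes zb: "zeros_bounded F S m"
  shows "finite {x\<in>S. F x = 0}" and "(\<Sum>x | x \<in> S \<and> F x = 0. zero_multiplicity F x) \<le> enat m"
proof -
  let ?Z = "{x\<in>S. F x = 0}"
  have bound: "card A \<le> m" if "finite A" "A \<subseteq> ?Z" for A
    using zb[unfolded zeros_bounded_def, rule_format, of A "\<lambda>_. 1"] that by (auto simp: vanishes_Suc)
  show fin: "finite ?Z"
  proof (rule ccontr)
    assume "infinite ?Z"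
    then obtain A where "A \<subseteq> ?Z" "finite A" "card A = Suc m" using infinite_arbitrarily_large by blast
    then show False using bound[of A] by simp
  qed
  define \<mu> where "\<mu> x = (LEAST i. (deriv ^^ i) F x \<noteq> 0)" for x
  have mult: "zero_multiplicity F x = enat (\<mu> x) \<and> vanishes F x (\<mu> x)" if "x \<in> S" for x
  proof -
    have ex: "\<exists>i. (deriv ^^ i) F x \<noteq> 0"
    proof (rule ccontr)
      assume "\<nexists>i. (deriv ^^ i) F x \<noteq> 0"
      then have "vanishes F x (Suc m)" by (simp add: vanishes_def)
      then show False using zb[unfolded zeros_bounded_def, rule_format, of "{x}" "\<lambda>_. Suc m"] that by simp
    qed
    have "zero_multiplicity F x = enat (\<mu> x)"
      unfolding zero_multiplicity_def
    proof (rule antisym)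
      show "(INF i\<in>{i. (deriv ^^ i) F x \<noteq> 0}. enat i) \<le> enat (\<mu> x)"
        by (rule INF_lower) (use LeastI_ex[OF ex] in \<open>simp add: \<mu>_def\<close>)
      show "enat (\<mu> x) \<le> (INF i\<in>{i. (deriv ^^ i) F x \<noteq> 0}. enat i)"
        by (rule INF_greatest) (auto simp: \<mu>_def intro: Least_le)
    qed
    moreover have "vanishes F x (\<mu> x)" unfolding vanishes_def \<mu>_def using not_less_Least by blast
    ultimately show ?thesis by blast
  qed
  have "(\<Sum>x\<in>?Z. zero_multiplicity F x) = (\<Sum>x\<in>?Z. enat (\<mu> x))"
    by (rule sum.cong) (use mult in auto)
  also have "\<dots> = enat (\<Sum>x\<in>?Z. \<mu> x)"
    using of_nat_sum[where 'a = enat, of \<mu> ?Z] by (simp add: of_nat_eq_enat)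
  also have "\<dots> \<le> enat m"
    using zb[unfolded zeros_bounded_def, rule_format, of ?Z \<mu>] fin mult by auto
  finally show "(\<Sum>x | x \<in> S \<and> F x = 0. zero_multiplicity F x) \<le> enat m" .
qed

text \<open>The Wronskian criterion without determinants: the Wronskian of the first
  \<open>m\<close> functions is zero at \<open>x\<close> exactly if some nontrivial combination of
  them vanishes to order \<open>m\<close> there.\<close>

theorem ECT_systemI:
  assumes S: "is_interval S" "open S"
    and an: "\<And>j x. j < n \<Longrightarrow> x \<in> S \<Longrightarrow> ranalytic_at (g j) x"
    and no: "\<And>m c x. m \<in> {1..n} \<Longrightarrow> \<exists>j<m. c j \<noteq> 0 \<Longrightarrow> x \<in> S \<Longrightarrow> \<not> vanishes (\<lambda>x. \<Sum>j<m. c j * g j x) x m"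
  shows "ECT_system n g S"
  unfolding ECT_system_def
proof (intro conjI allI impI ballI)
  show "real_analytic_on (g j) S" if "j < n" for j
    using an that S(2) by (simp add: real_analytic_on_open_iff)
  fix k and c :: "nat \<Rightarrow> real" assume k: "k \<in> {1..n}" and c: "\<exists>j<k. c j \<noteq> 0"
  have "zeros_bounded (\<lambda>x. \<Sum>j<k. c j * g j x) S (k - 1)"
    using k c by (intro zeros_bounded_if_no_high_order_zero S an no) auto
  from zeros_bounded_imp_zero_multiplicity[OF this]
  show "finite {x \<in> S. (\<Sum>j<k. c j * g j x) = 0}"
    and "(\<Sum>x | x \<in> S \<and> (\<Sum>j<k. c j * g j x) = 0. zero_multiplicity (\<lambda>x. \<Sum>j<k. c j * g j x) x) \<le> enat (k - 1)"
    by auto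
qed

section \<open>Abel integrals\<close>

lemma has_bochner_integral_powr:
  assumes "\<gamma> > -1" "d \<ge> (0::real)"
  shows "has_bochner_integral lborel (\<lambda>x. indicator {0<..<d} x * x powr \<gamma>) (d powr (\<gamma> + 1) / (\<gamma> + 1))"
proof -
  have "((\<lambda>x. x powr \<gamma>) has_integral d powr (\<gamma> + 1) / (\<gamma> + 1)) {0<..<d}"
    using has_integral_powr_from_0[OF assms] by (simp add: has_integral_Icc_iff_Ioo)
  then have "((\<lambda>x. if x \<in> {0<..<d} then x powr \<gamma> else 0) has_integral d powr (\<gamma> + 1) / (\<gamma> + 1)) UNIV"
    by (simp only: has_integral_restrict_UNIV)
  moreover have "(\<lambda>x. if x \<in> {0<..<d} then x powr \<gamma> else 0) = (\<lambda>x. indicator {0<..<d} x * x powr \<gamma>)"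
    by (auto simp: indicator_def)
  ultimately have "((\<lambda>x. indicator {0<..<d} x * x powr \<gamma>) has_integral d powr (\<gamma> + 1) / (\<gamma> + 1)) UNIV"
    by simp
  then have "integral\<^sup>N lborel (\<lambda>x. indicator {0<..<d} x * x powr \<gamma>) = d powr (\<gamma> + 1) / (\<gamma> + 1)"
    by (intro nn_integral_has_integral_lborel) auto
  then show ?thesis using assms by (intro has_bochner_integral_nn_integral) auto
qed

lemma has_bochner_integral_powr_right:
  assumes "\<gamma> > -1" "c \<le> (h::real)"
  shows "has_bochner_integral lborel (\<lambda>v. indicator {c<..<h} v * (v - c) powr \<gamma>) ((h - c) powr (\<gamma> + 1) / (\<gamma> + 1))"
proof -
  have "has_bochner_integral lborel (\<lambda>x. indicator {0<..<h - c} (- c + 1 * x) * (- c + 1 * x) powr \<gamma>)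
      ((h - c) powr (\<gamma> + 1) / (\<gamma> + 1) /\<^sub>R \<bar>1\<bar>)"
    using lborel_has_bochner_integral_real_affine_iff[of 1, THEN iffD1] has_bochner_integral_powr[OF assms(1), of "h - c"] assms(2) by fastforce
  moreover have "(\<lambda>x. indicator {0<..<h - c} (- c + 1 * x) * (- c + 1 * x) powr \<gamma>) = (\<lambda>v. indicator {c<..<h} v * (v - c) powr \<gamma>)"
    by (auto simp: indicator_def)
  ultimately show ?thesis by simp
qed

lemma has_bochner_integral_powr_left:
  assumes "\<gamma> > -1" "c \<le> (h::real)"
  shows "has_bochner_integral lborel (\<lambda>u. indicator {c<..<h} u * (h - u) powr \<gamma>) ((h - c) powr (\<gamma> + 1) / (\<gamma> + 1))"
proof -
  have "has_bochner_integral lborel (\<lambda>x. indicator {0<..<h - c} (h + (-1) * x) * (h + (-1) * x) powr \<gamma>)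
      ((h - c) powr (\<gamma> + 1) / (\<gamma> + 1) /\<^sub>R \<bar>-1\<bar>)"
    using lborel_has_bochner_integral_real_affine_iff[of "-1", THEN iffD1] has_bochner_integral_powr[OF assms(1), of "h - c"] assms(2) by fastforce
  moreover have "(\<lambda>x. indicator {0<..<h - c} (h + (-1) * x) * (h + (-1) * x) powr \<gamma>) = (\<lambda>v. indicator {c<..<h} v * (h - v) powr \<gamma>)"
    by (auto simp: indicator_def)
  ultimately show ?thesis by simp
qed

text \<open>Up to the factor \<open>Gamma (\<beta> + 1)\<close> this is the Riemann-Liouville
  fractional integral of order \<open>\<beta> + 1\<close>.\<close>

definition abel :: "real \<Rightarrow> (real \<Rightarrow> real) \<Rightarrow> real \<Rightarrow> real" where
  "abel \<beta> g h = (LBINT u:{0<..<h}. g u * (h - u) powr \<beta>)"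

text \<open>No bound on \<open>g\<close> near \<open>0\<close> is imposed. The end \<open>b\<close>
  is auxiliary and lies strictly beyond the energies considered, so that \<open>g\<close> is
  analytic at the upper limit of integration.\<close>

locale abel_density =
  fixes g :: "real \<Rightarrow> real" and b :: real
  assumes analytic: "\<And>x. 0 < x \<Longrightarrow> x < b \<Longrightarrow> ranalytic_at g x"
    and integrable: "set_integrable lborel {0<..<b} g"
begin

lemma measurable_density:
  assumes "A \<in> sets borel" "A \<subseteq> {0<..<b}"
  shows "(\<lambda>u. indicator A u * g u) \<in> borel_measurable borel"
  using set_integrable_subset[OF integrable, of A] assms
  unfolding set_integrable_def by (auto dest: borel_measurable_integrable)

text \<open>The two difficulties sit at opposite ends. On the left half the power is bounded and
  \<open>g\<close> is integrable; on the right half \<open>g\<close> is bounded by compactness and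
  the power is integrable since \<open>\<beta> > -1\<close>.\<close>

lemma integrable_times_powr:
  assumes h: "0 < h" "h < b" and \<beta>: "\<beta> > -1"
  shows "set_integrable lborel {0<..<h} (\<lambda>u. g u * (h - u) powr \<beta>)"
proof -
  have meas: "set_borel_measurable lborel A (\<lambda>u. g u * (h - u) powr \<beta>)" if "A \<in> sets borel" "A \<subseteq> {0<..<b}" for A
  proof -
    note [measurable] = measurable_density[OF that]
    have "(\<lambda>u. indicator A u *\<^sub>R (g u * (h - u) powr \<beta>)) = (\<lambda>u. (indicator A u * g u) * (h - u) powr \<beta>)"
      by (auto simp: algebra_simps)
    then show ?thesis unfolding set_borel_measurable_def by simp
  qed
  have left: "set_integrable lborel {0<..h/2} (\<lambda>u. g u * (h - u) powr \<beta>)"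
  proof (rule set_integrable_bound)
    let ?C = "max ((h/2) powr \<beta>) (h powr \<beta>)"
    show "set_integrable lborel {0<..h/2} (\<lambda>u. ?C * g u)"
      using h by (intro set_integrable_mult_right set_integrable_subset[OF integrable]) auto
    show "set_borel_measurable lborel {0<..h/2} (\<lambda>u. g u * (h - u) powr \<beta>)"
      using h by (intro meas) auto
    have "(h - u) powr \<beta> \<le> ?C" if "0 < u" "u \<le> h/2" for u
    proof (cases "\<beta> \<ge> 0")
      case True
      then have "(h - u) powr \<beta> \<le> h powr \<beta>" using that by (intro powr_mono2) auto
      then show ?thesis by simp
    next
      case False
      then have "(h - u) powr \<beta> \<le> (h/2) powr \<beta>" using that h by (intro powr_mono2') auto
      then show ?thesis by simp
    qed
    then have "\<bar>g u\<bar> * (h - u) powr \<beta> \<le> ?C * \<bar>g u\<bar>" if "0 < u" "u \<le> h/2" for u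
      using that by (metis abs_ge_zero mult.commute mult_left_mono)
    moreover have "?C \<ge> 0" by (simp add: le_max_iff_disj)
    ultimately show "AE u in lborel. u \<in> {0<..h/2} \<longrightarrow> norm (g u * (h - u) powr \<beta>) \<le> norm (?C * g u)"
      by (intro AE_I2) (auto simp: abs_mult)
  qed
  have "continuous_on {h/2..h} g"
    using h by (intro continuous_at_imp_continuous_on ballI ranalytic_at_isCont analytic) auto
  then have "bounded (g ` {h/2..h})" by (intro compact_imp_bounded compact_continuous_image) auto
  then obtain M where M: "M > 0" "\<forall>u\<in>{h/2..h}. \<bar>g u\<bar> \<le> M" unfolding bounded_pos by auto
  have "set_integrable lborel {h/2<..<h} (\<lambda>u. g u * (h - u) powr \<beta>)"
  proof (rule set_integrable_bound)
    show "set_integrable lborel {h/2<..<h} (\<lambda>u. M * (h - u) powr \<beta>)"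
      using has_bochner_integral_powr_left[OF \<beta>, of "h/2" h] h
      by (intro set_integrable_mult_right) (auto simp: set_integrable_def has_bochner_integral_iff)
    show "set_borel_measurable lborel {h/2<..<h} (\<lambda>u. g u * (h - u) powr \<beta>)"
      using h by (intro meas) auto
    show "AE u in lborel. u \<in> {h/2<..<h} \<longrightarrow> norm (g u * (h - u) powr \<beta>) \<le> norm (M * (h - u) powr \<beta>)"
      using M by (intro AE_I2) (auto simp: abs_mult intro!: mult_right_mono)
  qed
  with left have "set_integrable lborel ({0<..h/2} \<union> {h/2<..<h}) (\<lambda>u. g u * (h - u) powr \<beta>)"
    by (rule set_integrable_Un) auto
  moreover have "{0<..h/2} \<union> {h/2<..<h} = {0<..<h}" using h by auto
  ultimately show ?thesis by simp
qed

text \<open>Integrating \<open>abel (\<beta> - 1) g\<close> reproduces \<open>abel \<beta> g\<close> by Fubini, because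
  \<open>\<integral> (v - u)\<^sup>\<beta>\<^sup>-\<^sup>1 dv\<close> over \<open>(u, h)\<close> is \<open>(h - u)\<^sup>\<beta> / \<beta>\<close>.\<close>

lemma abel_eq_integral_abel:
  assumes h: "0 < h" "h < b" and \<beta>: "\<beta> > 0"
  shows "set_integrable lborel {0<..<h} (abel (\<beta> - 1) g)"
    and "abel \<beta> g h = \<beta> * (LBINT v:{0<..<h}. abel (\<beta> - 1) g v)"
proof -
  define g0 where "g0 u = indicator {0<..<h} u * g u" for u
  have [measurable]: "g0 \<in> borel_measurable borel"
    unfolding g0_def using h by (intro measurable_density) auto
  define K where "K u v = (if u < v \<and> v < h then g0 u * (v - u) powr (\<beta> - 1) else 0)" for u v
  have inner: "has_bochner_integral lborel (K u) (indicator {0<..<h} u * (g u * ((h - u) powr \<beta> / \<beta>)))" for u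
  proof (cases "0 < u \<and> u < h")
    case True
    then have "has_bochner_integral lborel (\<lambda>v. g u * (indicator {u<..<h} v * (v - u) powr (\<beta> - 1))) (g u * ((h - u) powr (\<beta> - 1 + 1) / (\<beta> - 1 + 1)))"
      using \<beta> by (intro has_bochner_integral_mult_right has_bochner_integral_powr_right) auto
    moreover have "(\<lambda>v. g u * (indicator {u<..<h} v * (v - u) powr (\<beta> - 1))) = K u"
      using True by (auto simp: K_def g0_def indicator_def)
    ultimately show ?thesis using True by simp
  next
    case False
    then have "K u = (\<lambda>_. 0)" by (auto simp: K_def g0_def indicator_def)
    then show ?thesis using False by (simp add: has_bochner_integral_zero)
  qed
  have norm_inner: "(LBINT v. norm (K u v)) = norm (indicator {0<..<h} u * (g u * ((h - u) powr \<beta> / \<beta>)))" for u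
  proof -
    \<comment> \<open>For fixed \<open>u\<close> the sign of \<open>K u v\<close> is that of
      \<open>g0 u\<close>, independently of \<open>v\<close>; so the integral of the norm follows
      from the one already computed.\<close>
    have "(LBINT v. norm (K u v)) = (LBINT v. sgn (g0 u) * K u v)"
      by (intro Bochner_Integration.integral_cong) (auto simp: K_def abs_mult sgn_if)
    also have "\<dots> = sgn (g0 u) * (indicator {0<..<h} u * (g u * ((h - u) powr \<beta> / \<beta>)))"
      using inner[of u] by (simp add: has_bochner_integral_iff)
    also have "\<dots> = norm (indicator {0<..<h} u * (g u * ((h - u) powr \<beta> / \<beta>)))"
      using \<beta> by (auto simp: g0_def indicator_def abs_mult sgn_if)
    finally show ?thesis .
  qed
  have outer: "integrable lborel (\<lambda>u. indicator {0<..<h} u * (g u * ((h - u) powr \<beta> / \<beta>)))"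
    using integrable_times_powr[OF h, of \<beta>] \<beta> unfolding set_integrable_def
    by (auto dest!: integrable_mult_left[of "1/\<beta>"] simp: mult.assoc)
  have int: "integrable (lborel \<Otimes>\<^sub>M lborel) (\<lambda>(u, v). K u v)"
  proof (rule lborel_pair.Fubini_integrable)
    show "(\<lambda>(u, v). K u v) \<in> borel_measurable (lborel \<Otimes>\<^sub>M lborel)"
      unfolding K_def by measurable
    show "integrable lborel (\<lambda>u. LBINT v. norm (case (u, v) of (u, v) \<Rightarrow> K u v))"
      unfolding prod.case norm_inner by (rule integrable_norm[OF outer])
    show "AE u in lborel. integrable lborel (\<lambda>v. case (u, v) of (u, v) \<Rightarrow> K u v)"
      using inner by (auto simp: has_bochner_integral_iff)
  qed
  have abel_K: "(LBINT u. K u v) = indicator {0<..<h} v * abel (\<beta> - 1) g v" for v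
  proof -
    have "(LBINT u. K u v) = (LBINT u. indicator {0<..<h} v * (indicator {0<..<v} u * (g u * (v - u) powr (\<beta> - 1))))"
      by (intro Bochner_Integration.integral_cong) (auto simp: K_def g0_def indicator_def)
    then show ?thesis by (simp add: abel_def set_lebesgue_integral_def)
  qed
  have "integrable lborel (\<lambda>v. LBINT u. K u v)"
    using lborel_pair.integrable_snd[OF int] by simp
  then show "set_integrable lborel {0<..<h} (abel (\<beta> - 1) g)"
    unfolding abel_K set_integrable_def by simp
  have "(LBINT v. LBINT u. K u v) = (LBINT u. LBINT v. K u v)"
    using lborel_pair.Fubini_integral[OF int] by simp
  also have "(LBINT u. LBINT v. K u v) = (LBINT u. indicator {0<..<h} u * (g u * (h - u) powr \<beta>) / \<beta>)"
    using inner by (intro Bochner_Integration.integral_cong) (auto simp: has_bochner_integral_iff)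
  also have "\<dots> = abel \<beta> g h / \<beta>" by (simp add: abel_def set_lebesgue_integral_def)
  finally show "abel \<beta> g h = \<beta> * (LBINT v:{0<..<h}. abel (\<beta> - 1) g v)"
    using \<beta> by (simp add: abel_K set_lebesgue_integral_def)
qed

end

section \<open>Analyticity and differentiation of Abel integrals\<close>

context abel_density begin

text \<open>Binomial series of the kernel: \<open>h - u = (x - u) * (1 + z)\<close> with
  \<open>z = (h - x) / (x - u)\<close>. Since \<open>x - u \<ge> x - d\<close> on the range of
  integration, the series converges for \<open>\<bar>h - x\<bar> < x - d\<close> with bounds uniform
  in \<open>u\<close> and may be integrated term by term against \<open>g\<close>.\<close>

lemma ranalytic_at_abel_far:
  assumes d: "0 < d" "d < x" "x < b"
  shows "ranalytic_at (\<lambda>h. LBINT u:{0<..d}. g u * (h - u) powr \<beta>) x"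
proof -
  define \<rho> where "\<rho> = x - d"
  have \<rho>: "\<rho> > 0" using d by (simp add: \<rho>_def)
  define g0 where "g0 u = indicator {0<..d} u * g u" for u
  have [measurable]: "g0 \<in> borel_measurable borel"
    unfolding g0_def using d by (intro measurable_density) auto
  have int0: "integrable lborel g0"
    using set_integrable_subset[OF integrable, of "{0<..d}"] d unfolding g0_def set_integrable_def by (simp add: subset_iff)
  define C where "C = max (\<rho> powr \<beta>) (x powr \<beta>)"
  have C: "(x - u) powr \<beta> \<le> C" if "0 < u" "u \<le> d" for u
  proof (cases "\<beta> \<ge> 0")
    case True
    then have "(x - u) powr \<beta> \<le> x powr \<beta>" using that d by (intro powr_mono2) auto
    then show ?thesis by (simp add: C_def)
  next
    case False
    then have "(x - u) powr \<beta> \<le> \<rho> powr \<beta>" using that \<rho> by (intro powr_mono2') (auto simp: \<rho>_def)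
    then show ?thesis by (simp add: C_def)
  qed
  \<comment> \<open>Up to the binomial coefficient, the density of the coefficient of
    \<open>(h - x) ^ n\<close>.\<close>
  define k where "k n u = g0 u * (x - u) powr \<beta> * (1 / (x - u)) ^ n" for n u
  have k_bound: "norm (k n u) \<le> norm (C * (1 / \<rho>) ^ n * g0 u)" for n u
  proof (cases "0 < u \<and> u \<le> d")
    case True
    then have "\<rho> \<le> x - u" by (simp add: \<rho>_def)
    then have "(1 / (x - u)) ^ n \<le> (1 / \<rho>) ^ n" using \<rho> by (intro power_mono frac_le) auto
    moreover have "(x - u) powr \<beta> \<le> C" using True C by auto
    ultimately have "(x - u) powr \<beta> * (1 / (x - u)) ^ n \<le> C * (1 / \<rho>) ^ n"
      using True d by (intro mult_mono) (auto intro: order_trans[OF powr_ge_zero])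
    moreover have "norm (k n u) = \<bar>g0 u\<bar> * ((x - u) powr \<beta> * (1 / (x - u)) ^ n)"
      using True d by (simp add: k_def abs_mult)
    moreover have "0 \<le> C * (1 / \<rho>) ^ n" using \<rho> by (simp add: C_def le_max_iff_disj)
    moreover have "norm (C * (1 / \<rho>) ^ n * g0 u) = \<bar>g0 u\<bar> * (C * (1 / \<rho>) ^ n)" if "0 \<le> C * (1 / \<rho>) ^ n"
      using that by (simp only: real_norm_def abs_mult[of "C * (1 / \<rho>) ^ n" "g0 u"] abs_of_nonneg) (rule mult.commute)
    ultimately show ?thesis by (simp only: mult_left_mono abs_ge_zero)
  qed (auto simp: k_def g0_def)
  have int_k: "integrable lborel (k n)" for n
  proof (rule Bochner_Integration.integrable_bound)
    show "integrable lborel (\<lambda>u. C * (1 / \<rho>) ^ n * g0 u)" using int0 by simp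
    show "k n \<in> borel_measurable lborel" unfolding k_def by measurable
  qed (use k_bound in auto)
  define d' where "d' n = (\<beta> gchoose n) * (LBINT u. k n u)" for n
  define J where "J = (LBINT u. C * norm (g0 u))"
  have norm_k: "(LBINT u. norm (k n u)) \<le> (1 / \<rho>) ^ n * J" for n
  proof -
    have "(LBINT u. norm (k n u)) \<le> (LBINT u. (1 / \<rho>) ^ n * (C * norm (g0 u)))"
    proof (rule integral_mono)
      show "norm (k n u) \<le> (1 / \<rho>) ^ n * (C * norm (g0 u))" for u
        using k_bound[of n u] \<rho> by (simp add: abs_mult C_def max_def mult_ac)
    qed (use int_k int0 in auto)
    then show ?thesis by (simp add: J_def)
  qed
  have "(\<lambda>n. d' n * (y - x) ^ n) sums (LBINT u:{0<..d}. g u * (y - u) powr \<beta>)" if y: "\<bar>y - x\<bar> < \<rho>" for y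
  proof -
    define f where "f n u = (\<beta> gchoose n) * (y - x) ^ n * k n u" for n u
    have pointwise: "(\<lambda>n. f n u) sums (g0 u * (y - u) powr \<beta>)" for u
    proof (cases "0 < u \<and> u \<le> d")
      case True
      then have xu: "x - u \<ge> \<rho>" "x - u > 0" using \<rho> by (auto simp: \<rho>_def)
      define z where "z = (y - x) / (x - u)"
      have z: "\<bar>z\<bar> < 1" using y xu by (simp add: z_def)
      have "(\<lambda>n. g0 u * (x - u) powr \<beta> * ((\<beta> gchoose n) * z ^ n)) sums (g0 u * (x - u) powr \<beta> * (1 + z) powr \<beta>)"
        by (intro sums_mult gen_binomial_real z)
      moreover have "(x - u) powr \<beta> * (1 + z) powr \<beta> = (y - u) powr \<beta>"
      proof -
        have "1 + z > 0" using z by auto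
        then have "(x - u) powr \<beta> * (1 + z) powr \<beta> = ((x - u) * (1 + z)) powr \<beta>"
          using xu by (simp add: powr_mult)
        also have "(x - u) * (1 + z) = y - u" using xu by (simp add: z_def field_simps)
        finally show ?thesis .
      qed
      ultimately show ?thesis
        by (simp add: f_def k_def z_def power_divide mult_ac)
    qed (auto simp: f_def k_def g0_def)
    have abs_sum: "summable (\<lambda>n. \<bar>\<beta> gchoose n\<bar> * \<bar>y - x\<bar> ^ n * ((1 / \<rho>) ^ n * J))"
    proof -
      have "ereal (norm (\<bar>y - x\<bar> / \<rho>)) < conv_radius (\<lambda>n. \<beta> gchoose n)"
        using y \<rho> by (auto simp: conv_radius_gchoose)
      then have "summable (\<lambda>n. norm ((\<beta> gchoose n) * (\<bar>y - x\<bar> / \<rho>) ^ n) * J)"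
        by (intro summable_mult2 abs_summable_in_conv_radius)
      then show ?thesis using \<rho> by (simp add: abs_mult power_divide mult_ac)
    qed
    have "(\<lambda>n. integral\<^sup>L lborel (f n)) sums (LBINT u. \<Sum>n. f n u)"
    proof (rule sums_integral)
      show "integrable lborel (f n)" for n unfolding f_def using int_k by simp
      show "AE u in lborel. summable (\<lambda>n. norm (f n u))"
      proof (rule AE_I2)
        fix u
        show "summable (\<lambda>n. norm (f n u))"
        proof (rule summable_comparison_test')
          have "summable (\<lambda>n. norm ((\<beta> gchoose n) * (\<bar>y - x\<bar> / \<rho>) ^ n) * norm (C * g0 u))"
            using y \<rho> by (intro summable_mult2 abs_summable_in_conv_radius) (auto simp: conv_radius_gchoose)
          then show "summable (\<lambda>n. \<bar>\<beta> gchoose n\<bar> * \<bar>y - x\<bar> ^ n * norm (C * (1 / \<rho>) ^ n * g0 u))"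
            using \<rho> by (simp add: abs_mult power_divide mult_ac power_abs)
          show "norm (norm (f n u)) \<le> \<bar>\<beta> gchoose n\<bar> * \<bar>y - x\<bar> ^ n * norm (C * (1 / \<rho>) ^ n * g0 u)" for n
            unfolding f_def norm_mult using k_bound[of n u]
            by (simp add: power_abs abs_mult mult_left_mono)
        qed
      qed
      show "summable (\<lambda>n. LBINT u. norm (f n u))"
      proof (rule summable_comparison_test'[OF abs_sum])
        show "norm (LBINT u. norm (f n u)) \<le> \<bar>\<beta> gchoose n\<bar> * \<bar>y - x\<bar> ^ n * ((1 / \<rho>) ^ n * J)" for n
          using norm_k[of n] unfolding f_def norm_mult
          by (simp add: power_abs mult_left_mono)
      qed
    qed
    moreover have "integral\<^sup>L lborel (f n) = d' n * (y - x) ^ n" for n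
      unfolding f_def d'_def by simp
    moreover have "(LBINT u. \<Sum>n. f n u) = (LBINT u:{0<..d}. g u * (y - u) powr \<beta>)"
      using pointwise by (simp add: sums_iff set_lebesgue_integral_def g0_def mult.assoc)
    ultimately show ?thesis by simp
  qed
  then show ?thesis unfolding ranalytic_at_iff_sums using \<rho> by blast
qed

text \<open>The substitution \<open>u = d + (h - d) * t\<close> fixes the domain of integration to
  \<open>(0, 1)\<close>. Inserting the power series of \<open>g\<close> about \<open>d\<close> gives
  \<open>(h - d) powr (\<beta> + 1)\<close> times a power series in \<open>h - d\<close>, and the
  power is analytic at \<open>x\<close> because \<open>x > d\<close>.\<close>

lemma ranalytic_at_abel_near:
  assumes d: "d < x" "x < d + r" and \<beta>: "\<beta> > -1"
    and c: "\<And>y. \<bar>y - d\<bar> < r \<Longrightarrow> (\<lambda>n. c n * (y - d) ^ n) sums g y"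
  shows "ranalytic_at (\<lambda>h. LBINT u:{d<..<h}. g u * (h - u) powr \<beta>) x"
proof -
  have r: "r > 0" using d by simp
  define k where "k n t = indicator {0<..<1} t * (t ^ n * (1 - t) powr \<beta>)" for n :: nat and t :: real
  have int0: "integrable lborel (\<lambda>t::real. indicator {0<..<1} t * (1 - t) powr \<beta>)"
    using has_bochner_integral_powr_left[OF \<beta>, of 0 1] by (simp add: has_bochner_integral_iff)
  have k_bound: "norm (k n t) \<le> norm (indicator {0<..<1} t * (1 - t) powr \<beta>)" for n t
  proof (cases "0 < t \<and> t < 1")
    case True
    then have "t ^ n \<le> 1" by (simp add: power_le_one)
    then show ?thesis using True by (simp add: k_def abs_mult mult_left_le_one_le)
  qed (simp add: k_def)
  have int_k: "integrable lborel (k n)" for n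
  proof (rule Bochner_Integration.integrable_bound[OF int0])
    show "k n \<in> borel_measurable lborel" unfolding k_def by measurable
  qed (use k_bound in auto)
  \<comment> \<open>The Beta integral with parameters \<open>n + 1\<close> and
    \<open>\<beta> + 1\<close>. It is bounded in \<open>n\<close>, so the series with coefficients
    \<open>c n * B n\<close> still converges within radius \<open>r\<close>.\<close>
  define B where "B n = (LBINT t. k n t)" for n
  define J where "J = (LBINT t. norm (indicator {0<..<1} t * (1 - t) powr \<beta> :: real))"
  have norm_k: "(LBINT t. norm (k n t)) \<le> J" for n
    unfolding J_def using int_k int0 by (intro integral_mono k_bound) auto
  have B_bound: "\<bar>B n\<bar> \<le> J" for n
    using order_trans[OF integral_norm_bound norm_k[of n]] by (simp add: B_def)
  have abs_c: "summable (\<lambda>n. \<bar>c n\<bar> * \<bar>t\<bar> ^ n)" if "\<bar>t\<bar> < r" for t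
  proof -
    define t' where "t' = (r + \<bar>t\<bar>) / 2"
    have "\<bar>t'\<bar> < r" "\<bar>t\<bar> < \<bar>t'\<bar>" using that by (auto simp: t'_def)
    then have "summable (\<lambda>n. c n * t' ^ n)" using c[of "d + t'"] by (auto simp: sums_iff)
    then have "summable (\<lambda>n. norm (c n * t ^ n))" by (rule powser_insidea) (use \<open>\<bar>t\<bar> < \<bar>t'\<bar>\<close> in simp)
    then show ?thesis by (simp add: abs_mult power_abs)
  qed
  have "ranalytic_at (\<lambda>h. (h - d) powr (\<beta> + 1) * (\<Sum>n. (c n * B n) * (h - d) ^ n)) x"
  proof (rule ranalytic_at_mult[OF _ ranalytic_at_powser[OF r]])
    have "ranalytic_at (\<lambda>h. h - d) x" by (rule ranalytic_at_diff[OF ranalytic_at_id ranalytic_at_const])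
    then show "ranalytic_at (\<lambda>h. (h - d) powr (\<beta> + 1)) x"
      by (rule ranalytic_at_compose[where k = "\<lambda>y. y powr (\<beta> + 1)"]) (use d in \<open>simp add: ranalytic_at_powr\<close>)
    show "summable (\<lambda>n. c n * B n * t ^ n)" if "\<bar>t\<bar> < r" for t
    proof (rule summable_comparison_test')
      show "summable (\<lambda>n. \<bar>c n\<bar> * \<bar>t\<bar> ^ n * J)" by (intro summable_mult2 abs_c that)
      show "norm (c n * B n * t ^ n) \<le> \<bar>c n\<bar> * \<bar>t\<bar> ^ n * J" for n
        using mult_left_mono[OF B_bound[of n], of "\<bar>c n\<bar> * \<bar>t\<bar> ^ n"] by (simp add: abs_mult power_abs mult_ac)
    qed
    show "\<bar>x - d\<bar> < r" using d by simp
  qed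
  moreover have "(h - d) powr (\<beta> + 1) * (\<Sum>n. (c n * B n) * (h - d) ^ n) = (LBINT u:{d<..<h}. g u * (h - u) powr \<beta>)"
    if h: "d < h" "h < d + r" for h
  proof -
    define \<eta> where "\<eta> = h - d"
    have \<eta>: "\<eta> > 0" "\<eta> < r" using h by (auto simp: \<eta>_def)
    define f where "f n t = c n * \<eta> ^ n * k n t" for n t
    have pointwise: "(\<lambda>n. f n t) sums (indicator {0<..<1} t * (g (d + \<eta> * t) * (1 - t) powr \<beta>))" for t
    proof (cases "0 < t \<and> t < 1")
      case True
      have "\<eta> * t < r" using True \<eta> by (smt (verit) mult_left_le)
      then have "(\<lambda>n. c n * (\<eta> * t) ^ n * (1 - t) powr \<beta>) sums (g (d + \<eta> * t) * (1 - t) powr \<beta>)"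
        using c[of "d + \<eta> * t"] True \<eta> by (intro sums_mult2) simp
      then show ?thesis using True by (simp add: f_def k_def power_mult_distrib mult_ac)
    qed (auto simp: f_def k_def)
    have "(\<lambda>n. integral\<^sup>L lborel (f n)) sums (LBINT t. \<Sum>n. f n t)"
    proof (rule sums_integral)
      show "integrable lborel (f n)" for n unfolding f_def using int_k by simp
      have s: "summable (\<lambda>n. \<bar>c n\<bar> * \<eta> ^ n)" using abs_c[of \<eta>] \<eta> by simp
      show "AE t in lborel. summable (\<lambda>n. norm (f n t))"
      proof (rule AE_I2)
        fix t
        show "summable (\<lambda>n. norm (f n t))"
        proof (rule summable_comparison_test')
          show "summable (\<lambda>n. \<bar>c n\<bar> * \<eta> ^ n * norm (indicator {0<..<1} t * (1 - t) powr \<beta> :: real))"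
            by (intro summable_mult2 s)
          show "norm (norm (f n t)) \<le> \<bar>c n\<bar> * \<eta> ^ n * norm (indicator {0<..<1} t * (1 - t) powr \<beta> :: real)" for n
            using mult_left_mono[OF k_bound[of n t], of "\<bar>c n\<bar> * \<eta> ^ n"] \<eta> by (simp add: f_def abs_mult)
        qed
      qed
      show "summable (\<lambda>n. LBINT t. norm (f n t))"
      proof (rule summable_comparison_test'[OF summable_mult2[OF s, of J]])
        show "norm (LBINT t. norm (f n t)) \<le> \<bar>c n\<bar> * \<eta> ^ n * J" for n
          using mult_left_mono[OF norm_k[of n], of "\<bar>c n\<bar> * \<eta> ^ n"] \<eta> unfolding f_def norm_mult by simp
      qed
    qed
    moreover have "(LBINT t. \<Sum>n. f n t) = (LBINT t. indicator {0<..<1} t * (g (d + \<eta> * t) * (1 - t) powr \<beta>))"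
      using sums_unique[OF pointwise] by simp
    moreover have "integral\<^sup>L lborel (f n) = c n * B n * \<eta> ^ n" for n
      unfolding f_def B_def by simp
    ultimately have "(\<lambda>n. c n * B n * \<eta> ^ n) sums (LBINT t. indicator {0<..<1} t * (g (d + \<eta> * t) * (1 - t) powr \<beta>))"
      by simp
    then have "(\<Sum>n. (c n * B n) * \<eta> ^ n) = (LBINT t. indicator {0<..<1} t * (g (d + \<eta> * t) * (1 - t) powr \<beta>))"
      by (simp add: sums_iff)
    moreover have "(LBINT u:{d<..<h}. g u * (h - u) powr \<beta>)
        = \<eta> powr (\<beta> + 1) * (LBINT t. indicator {0<..<1} t * (g (d + \<eta> * t) * (1 - t) powr \<beta>))"
    proof -
      have "(LBINT u:{d<..<h}. g u * (h - u) powr \<beta>)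
          = \<bar>\<eta>\<bar> *\<^sub>R (LBINT t. indicator {d<..<h} (d + \<eta> * t) *\<^sub>R (g (d + \<eta> * t) * (h - (d + \<eta> * t)) powr \<beta>))"
        unfolding set_lebesgue_integral_def by (rule lborel_integral_real_affine) (use \<eta> in simp)
      also have "(LBINT t. indicator {d<..<h} (d + \<eta> * t) *\<^sub>R (g (d + \<eta> * t) * (h - (d + \<eta> * t)) powr \<beta>))
          = (LBINT t. \<eta> powr \<beta> * (indicator {0<..<1} t * (g (d + \<eta> * t) * (1 - t) powr \<beta>)))"
      proof (rule Bochner_Integration.integral_cong)
        fix t
        have "h - (d + \<eta> * t) = \<eta> * (1 - t)" by (simp add: \<eta>_def algebra_simps)
        moreover have "indicator {d<..<h} (d + \<eta> * t) = (indicator {0<..<1} t :: real)"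
        proof -
          have "d + \<eta> * t < h \<longleftrightarrow> \<eta> * t < \<eta> * 1" by (auto simp: \<eta>_def)
          also have "\<dots> \<longleftrightarrow> t < 1" using \<eta> by (simp only: mult_less_cancel_left_pos)
          finally show ?thesis using \<eta> by (auto simp: indicator_def zero_less_mult_iff)
        qed
        ultimately show "indicator {d<..<h} (d + \<eta> * t) *\<^sub>R (g (d + \<eta> * t) * (h - (d + \<eta> * t)) powr \<beta>)
          = \<eta> powr \<beta> * (indicator {0<..<1} t * (g (d + \<eta> * t) * (1 - t) powr \<beta>))"
          using \<eta> by (auto simp: indicator_def powr_mult)
      qed simp
      finally show ?thesis using \<eta> by (simp add: powr_add mult_ac)
    qed
    ultimately show ?thesis by (simp add: \<eta>_def)
  qed
  moreover have "\<forall>\<^sub>F h in nhds x. h \<in> {d<..<d + r}" using d by (intro eventually_nhds_in_open) auto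
  ultimately show ?thesis by (elim ranalytic_at_cong) (auto elim!: eventually_mono)
qed

text \<open>A cut at \<open>d\<close> below \<open>x\<close> leaves a part with fixed domain and
  smooth kernel, which tolerates any integrable \<open>g\<close>, and a part with singular kernel,
  on which \<open>g\<close> has a power series.\<close>

lemma ranalytic_at_abel:
  assumes x: "0 < x" "x < b" and \<beta>: "\<beta> > -1"
  shows "ranalytic_at (abel \<beta> g) x"
proof -
  obtain r where r: "r > 0" and near: "\<And>a. \<bar>a - x\<bar> < r \<Longrightarrow> \<exists>c. \<forall>y. \<bar>y - a\<bar> < 2 * r \<longrightarrow> (\<lambda>n. c n * (y - a) ^ n) sums g y"
    using ranalytic_at_nearby_sums[OF analytic[OF x]] by blast
  \<comment> \<open>The first entry keeps \<open>d\<close> positive; the second keeps it within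
    \<open>r / 2\<close> of \<open>x\<close>, so that \<open>x\<close> lies inside the disc of
    radius \<open>2 * r\<close> about \<open>d\<close>.\<close>
  define d where "d = max (x / 2) (x - r / 2)"
  have d: "0 < d" "d < x" "\<bar>d - x\<bar> < r" "x < d + 2 * r" using r x by (auto simp: d_def max_def)
  obtain c where c: "\<And>y. \<bar>y - d\<bar> < 2 * r \<Longrightarrow> (\<lambda>n. c n * (y - d) ^ n) sums g y" using near[OF d(3)] by blast
  have "ranalytic_at (\<lambda>h. (LBINT u:{0<..d}. g u * (h - u) powr \<beta>) + (LBINT u:{d<..<h}. g u * (h - u) powr \<beta>)) x"
    by (intro ranalytic_at_add ranalytic_at_abel_far ranalytic_at_abel_near[OF d(2,4) \<beta> c] d x)
  moreover have "(LBINT u:{0<..d}. g u * (h - u) powr \<beta>) + (LBINT u:{d<..<h}. g u * (h - u) powr \<beta>) = abel \<beta> g h"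
    if h: "h \<in> {d<..<b}" for h
  proof -
    have i: "set_integrable lborel {0<..<h} (\<lambda>u. g u * (h - u) powr \<beta>)"
      using h d \<beta> by (intro integrable_times_powr) auto
    have "{0<..<h} = {0<..d} \<union> {d<..<h}" using h d by auto
    then show ?thesis unfolding abel_def
      by (subst set_integral_Un[symmetric]) (use h in \<open>auto intro!: set_integrable_subset[OF i]\<close>)
  qed
  moreover have "\<forall>\<^sub>F h in nhds x. h \<in> {d<..<b}" using d x by (intro eventually_nhds_in_open) auto
  ultimately show ?thesis by (elim ranalytic_at_cong) (auto elim!: eventually_mono)
qed

text \<open>For \<open>\<beta> < 1\<close> the differentiated kernel is unbounded at
  \<open>u = h\<close>. The formula comes instead from the fundamental theorem of calculus, applied
  to the representation of \<open>abel \<beta> g\<close> as an integral of the continuous function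
  \<open>abel (\<beta> - 1) g\<close>.\<close>

lemma has_real_derivative_abel:
  assumes x: "0 < x" "x < b" and \<beta>: "\<beta> > 0"
  shows "(abel \<beta> g has_real_derivative \<beta> * abel (\<beta> - 1) g x) (at x)"
proof -
  define lo hi where "lo = x / 2" and "hi = (x + b) / 2"
  have lohi: "0 < lo" "lo < x" "x < hi" "hi < b" using x by (auto simp: lo_def hi_def)
  let ?G = "abel (\<beta> - 1) g"
  have cont: "continuous_on {lo..hi} ?G"
    using lohi \<beta> by (intro continuous_at_imp_continuous_on ballI ranalytic_at_isCont ranalytic_at_abel) auto
  have "((\<lambda>h. integral {lo..h} ?G) has_real_derivative ?G x) (at x within {lo..hi})"
    using lohi by (intro integral_has_real_derivative cont) auto
  then have "((\<lambda>h. integral {lo..h} ?G) has_real_derivative ?G x) (at x)"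
    using lohi at_within_Icc_at[of lo x hi] by simp
  then have "((\<lambda>h. abel \<beta> g lo + \<beta> * integral {lo..h} ?G) has_real_derivative \<beta> * ?G x) (at x)"
    by (auto intro!: derivative_eq_intros)
  moreover have "abel \<beta> g lo + \<beta> * integral {lo..h} ?G = abel \<beta> g h" if h: "h \<in> {lo<..<hi}" for h
  proof -
    have i: "set_integrable lborel {0<..<h} ?G"
      using h lohi \<beta> by (intro abel_eq_integral_abel) auto
    have "{0<..<h} = {0<..<lo} \<union> {lo..<h}" using h lohi by auto
    then have "(LBINT v:{0<..<h}. ?G v) = (LBINT v:{0<..<lo}. ?G v) + (LBINT v:{lo..<h}. ?G v)"
      using h lohi by (simp, subst set_integral_Un) (auto intro!: set_integrable_subset[OF i])
    moreover have "(LBINT v:{lo..<h}. ?G v) = integral {lo..<h} ?G"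
      using h lohi by (intro set_borel_integral_eq_integral set_integrable_subset[OF i]) auto
    moreover have "integral {lo..<h} ?G = integral {lo..h} ?G"
      by (rule integral_subset_negligible) (auto intro: negligible_subset[of "{h}"])
    moreover have "abel \<beta> g h = \<beta> * (LBINT v:{0<..<h}. ?G v)" "abel \<beta> g lo = \<beta> * (LBINT v:{0<..<lo}. ?G v)"
      using h lohi \<beta> by (auto intro!: abel_eq_integral_abel)
    ultimately show ?thesis by (simp add: algebra_simps)
  qed
  moreover have "\<forall>\<^sub>F h in nhds x. h \<in> {lo<..<hi}" using lohi by (intro eventually_nhds_in_open) auto
  ultimately show ?thesis
    by (subst DERIV_cong_ev[OF refl _ refl, where g = "\<lambda>h. abel \<beta> g lo + \<beta> * integral {lo..h} ?G"])
       (auto elim!: eventually_mono)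
qed

end

section \<open>Zeros of Abel integrals\<close>

lemma continuous_nonzero_constant_sign:
  fixes g :: "real \<Rightarrow> real"
  assumes "continuous_on {lo<..<hi} g" "\<And>u. lo < u \<Longrightarrow> u < hi \<Longrightarrow> g u \<noteq> 0"
  obtains \<epsilon> where "\<epsilon> = 1 \<or> \<epsilon> = -1" "\<And>u. lo < u \<Longrightarrow> u < hi \<Longrightarrow> \<epsilon> * g u > 0"
proof -
  have "is_interval (g ` {lo<..<hi})"
    using connected_continuous_image[OF assms(1)] by (simp add: is_interval_connected_1)
  moreover have "0 \<notin> g ` {lo<..<hi}" using assms(2) by force
  ultimately have "(\<forall>v\<in>g ` {lo<..<hi}. v > 0) \<or> (\<forall>v\<in>g ` {lo<..<hi}. v < 0)"
    unfolding is_interval_1 by (metis linorder_not_less order_le_less)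
  then show thesis using that[of 1] that[of "-1"] by force
qed

text \<open>\<open>T\<close> collects the zeros at which \<open>g\<close> changes sign. In the
  induction the interval is cut at its largest zero \<open>z\<close>; to the right of
  \<open>z\<close> the product over \<open>T\<close> is positive, and \<open>z\<close> joins
  \<open>T\<close> exactly if the sign of \<open>g\<close> there disagrees with
  \<open>\<epsilon>\<close>, since the factor \<open>u - z\<close> reverses the sign on the left
  only.\<close>

lemma polynomial_sign_match:
  fixes g :: "real \<Rightarrow> real"
  assumes "continuous_on {lo<..<hi} g" "finite {u. lo < u \<and> u < hi \<and> g u = 0}"
  shows "\<exists>\<epsilon> T. (\<epsilon> = 1 \<or> \<epsilon> = -1) \<and> T \<subseteq> {u. lo < u \<and> u < hi \<and> g u = 0} \<and>
           (\<forall>u. lo < u \<longrightarrow> u < hi \<longrightarrow> 0 \<le> \<epsilon> * (g u * (\<Prod>t\<in>T. u - t)))"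
  using assms
proof (induction "card {u. lo < u \<and> u < hi \<and> g u = 0}" arbitrary: hi)
  case 0
  then have "\<And>u. lo < u \<Longrightarrow> u < hi \<Longrightarrow> g u \<noteq> 0" by auto
  then obtain \<epsilon> where "\<epsilon> = 1 \<or> \<epsilon> = -1" "\<And>u. lo < u \<Longrightarrow> u < hi \<Longrightarrow> \<epsilon> * g u > 0"
    using continuous_nonzero_constant_sign[OF "0.prems"(1)] by blast
  then show ?case by (intro exI[of _ \<epsilon>] exI[of _ "{}"]) (auto intro: less_imp_le)
next
  case (Suc m)
  let ?Z = "{u. lo < u \<and> u < hi \<and> g u = 0}"
  define z where "z = Max ?Z"
  have ne: "?Z \<noteq> {}" using Suc.hyps(2) by (metis card.empty nat.distinct(1))
  have z: "z \<in> ?Z" unfolding z_def using Suc.prems(2) ne by (rule Max_in)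
  have zmax: "u \<le> z" if "u \<in> ?Z" for u unfolding z_def using Suc.prems(2) that by (rule Max_ge)
  have Z': "{u. lo < u \<and> u < z \<and> g u = 0} = ?Z - {z}" using z zmax by (auto simp: order_less_le)
  have "\<exists>\<epsilon> T. (\<epsilon> = 1 \<or> \<epsilon> = -1) \<and> T \<subseteq> {u. lo < u \<and> u < z \<and> g u = 0} \<and>
           (\<forall>u. lo < u \<longrightarrow> u < z \<longrightarrow> 0 \<le> \<epsilon> * (g u * (\<Prod>t\<in>T. u - t)))"
  proof (rule Suc.hyps(1))
    show "m = card {u. lo < u \<and> u < z \<and> g u = 0}" unfolding Z' using Suc.hyps(2) Suc.prems(2) z by simp
    show "continuous_on {lo<..<z} g" by (rule continuous_on_subset[OF Suc.prems(1)]) (use z in auto)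
    show "finite {u. lo < u \<and> u < z \<and> g u = 0}" unfolding Z' using Suc.prems(2) by simp
  qed
  then obtain \<epsilon> T where \<epsilon>: "\<epsilon> = 1 \<or> \<epsilon> = -1" and T: "T \<subseteq> ?Z - {z}"
    and left: "\<And>u. lo < u \<Longrightarrow> u < z \<Longrightarrow> 0 \<le> \<epsilon> * (g u * (\<Prod>t\<in>T. u - t))"
    unfolding Z' by blast
  have "continuous_on {z<..<hi} g" by (rule continuous_on_subset[OF Suc.prems(1)]) (use z in auto)
  moreover have "g u \<noteq> 0" if "z < u" "u < hi" for u using zmax[of u] z that by auto
  ultimately obtain \<delta> where \<delta>: "\<delta> = 1 \<or> \<delta> = -1" and right: "\<And>u. z < u \<Longrightarrow> u < hi \<Longrightarrow> \<delta> * g u > 0"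
    using continuous_nonzero_constant_sign[of z hi g] by blast
  have Tpos: "(\<Prod>t\<in>T. u - t) > 0" if "z < u" for u
    using T that zmax by (intro prod_pos) force
  have finT: "finite T" "z \<notin> T" using T Suc.prems(2) finite_subset by auto
  show ?case
  proof (cases "\<delta> = \<epsilon>")
    case True
    have "0 \<le> \<epsilon> * (g u * (\<Prod>t\<in>T. u - t))" if "lo < u" "u < hi" for u
    proof (cases u z rule: linorder_cases)
      case greater
      then have "0 \<le> (\<delta> * g u) * (\<Prod>t\<in>T. u - t)"
        using mult_pos_pos[OF right Tpos, of u u] that by simp
      then show ?thesis using True by (simp add: mult.assoc)
    qed (use left that z in auto)
    then show ?thesis using \<epsilon> T by blast
  next
    case False
    then have \<delta>\<epsilon>: "\<delta> = - \<epsilon>" using \<epsilon> \<delta> by auto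
    have "0 \<le> \<delta> * (g u * (\<Prod>t\<in>insert z T. u - t))" if "lo < u" "u < hi" for u
    proof -
      have eq: "\<delta> * (g u * (\<Prod>t\<in>insert z T. u - t)) = (u - z) * (\<delta> * (g u * (\<Prod>t\<in>T. u - t)))"
        using finT by simp
      show ?thesis
      proof (cases u z rule: linorder_cases)
        case less
        then have "0 \<le> (z - u) * (\<epsilon> * (g u * (\<Prod>t\<in>T. u - t)))"
          using mult_nonneg_nonneg[OF _ left, of "z - u" u] that by simp
        then show ?thesis unfolding eq by (simp add: \<delta>\<epsilon> algebra_simps)
      next
        case greater
        then have "0 \<le> (u - z) * ((\<delta> * g u) * (\<Prod>t\<in>T. u - t))"
          using mult_pos_pos[OF _ mult_pos_pos[OF right Tpos], of "u - z" u u] that by simp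
        then show ?thesis unfolding eq by (simp add: mult.assoc)
      qed (use z in simp)
    qed
    moreover have "insert z T \<subseteq> ?Z" using T z by auto
    ultimately show ?thesis using \<delta> by blast
  qed
qed

context abel_density begin

text \<open>The bound on \<open>i\<close> keeps every exponent that is differentiated positive; the
  final one only has to exceed \<open>-1\<close>.\<close>

lemma higher_deriv_abel:
  assumes "0 < h" "h < b" "real i < \<beta> + 1"
  shows "(deriv ^^ i) (abel \<beta> g) h = (\<Prod>j<i. \<beta> - real j) * abel (\<beta> - real i) g h"
  using assms
proof (induction i arbitrary: h)
  case (Suc i)
  define C where "C = (\<Prod>j<i. \<beta> - real j)"
  have ev: "\<forall>\<^sub>F y in nhds h. (deriv ^^ i) (abel \<beta> g) y = C * abel (\<beta> - real i) g y"
    using eventually_nhds_in_open[of "{0<..<b}" h] Suc.prems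
    by (auto elim!: eventually_mono simp: C_def intro!: Suc.IH)
  have "((\<lambda>y. C * abel (\<beta> - real i) g y) has_real_derivative C * ((\<beta> - real i) * abel (\<beta> - real i - 1) g h)) (at h)"
    using Suc.prems by (intro DERIV_cmult has_real_derivative_abel) auto
  then have "deriv (\<lambda>y. C * abel (\<beta> - real i) g y) h = C * ((\<beta> - real i) * abel (\<beta> - real i - 1) g h)"
    by (rule DERIV_imp_deriv)
  then show ?case using deriv_cong_ev[OF ev refl] by (simp add: C_def algebra_simps)
qed simp

text \<open>If \<open>abel \<beta> g\<close> vanishes to order \<open>k\<close> at \<open>h\<close>, then \<open>g\<close> is orthogonal on \<open>(0, h)\<close> to all polynomials
  of degree below \<open>k\<close> with respect to the weight \<open>(h - u) powr (\<beta> - (k - 1))\<close>. This is impossible because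
  some such polynomial has the same sign changes as \<open>g\<close>.\<close>

lemma not_vanishes_abel:
  assumes h: "0 < h" "h < b" and k: "k > 0" and \<beta>: "\<beta> > real k - 2"
    and Z: "finite {u. 0 < u \<and> u < h \<and> g u = 0}" "card {u. 0 < u \<and> u < h \<and> g u = 0} \<le> k - 1"
  shows "\<not> vanishes (abel \<beta> g) h k"
proof
  assume van: "vanishes (abel \<beta> g) h k"
  have moments: "abel (\<beta> - real i) g h = 0" if "i < k" for i
  proof -
    \<comment> \<open>The factors have \<open>j < i < k\<close>, hence
      \<open>j \<le> k - 2 < \<beta>\<close>.\<close>
    have "(\<Prod>j<i. \<beta> - real j) \<noteq> 0" using that \<beta> by auto
    moreover have "(\<Prod>j<i. \<beta> - real j) * abel (\<beta> - real i) g h = 0"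
      using van that \<beta> higher_deriv_abel[OF h, of i \<beta>] unfolding vanishes_def by auto
    ultimately show ?thesis by simp
  qed
  have "continuous_on {0<..<h} g"
    using h by (intro continuous_at_imp_continuous_on ballI ranalytic_at_isCont analytic) auto
  then obtain \<epsilon> T where \<epsilon>: "\<epsilon> = 1 \<or> \<epsilon> = -1" and T: "T \<subseteq> {u. 0 < u \<and> u < h \<and> g u = 0}"
    and nonneg: "\<And>u. 0 < u \<Longrightarrow> u < h \<Longrightarrow> 0 \<le> \<epsilon> * (g u * (\<Prod>t\<in>T. u - t))"
    using polynomial_sign_match[OF _ Z(1)] by blast
  have finT: "finite T" and cardT: "card T \<le> k - 1"
    using T Z finite_subset card_mono[OF Z(1) T] by auto
  \<comment> \<open>Written in the variable \<open>w = h - u\<close>, in which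
    \<open>[:h - t, -1:]\<close> takes the value \<open>u - t\<close>; powers of \<open>w\<close>
    merge with the weight into the kernels of Abel integrals.\<close>
  define p where "p = smult \<epsilon> (\<Prod>t\<in>T. [:h - t, -1:])"
  have p: "poly p (h - u) = \<epsilon> * (\<Prod>t\<in>T. u - t)" for u
    by (simp add: p_def poly_prod)
  have "degree p \<le> k - 1"
  proof -
    have "degree p \<le> degree (\<Prod>t\<in>T. [:h - t, -1:])" unfolding p_def by (rule degree_smult_le)
    also have "\<dots> \<le> (\<Sum>t\<in>T. degree [:h - t, -1:])" using degree_prod_sum_le[OF finT, of "\<lambda>t. [:h - t, -1:]"] by (simp add: o_def)
    finally show ?thesis using cardT by simp
  qed
  then have poly_p: "poly p w = (\<Sum>i<k. coeff p i * w ^ i)" for w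
    unfolding poly_altdef using k by (intro sum.mono_neutral_left) (auto simp: coeff_eq_0)
  \<comment> \<open>The exponent reached by the derivative of order \<open>k - 1\<close>. The
    hypothesis on \<open>\<beta>\<close> says precisely that it exceeds \<open>-1\<close>; the
    derivative of order \<open>k - 1 - i\<close> has exponent
    \<open>\<gamma> + real i\<close>.\<close>
  define \<gamma> where "\<gamma> = \<beta> - (real k - 1)"
  have \<gamma>: "\<gamma> > -1" using \<beta> by (simp add: \<gamma>_def)
  define F where "F u = indicator {0<..<h} u * (g u * poly p (h - u) * (h - u) powr \<gamma>)" for u
  have F_sum: "F u = (\<Sum>i<k. coeff p i * (indicator {0<..<h} u *\<^sub>R (g u * (h - u) powr (\<gamma> + real i))))" for u
  proof (cases "0 < u \<and> u < h")
    case True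
    then have "(h - u) powr (\<gamma> + real i) = (h - u) ^ i * (h - u) powr \<gamma>" for i
      by (simp add: powr_add powr_realpow)
    then show ?thesis using True
      by (simp add: F_def poly_p sum_distrib_left sum_distrib_right mult_ac)
  qed (auto simp: F_def)
  have int_i: "set_integrable lborel {0<..<h} (\<lambda>u. g u * (h - u) powr (\<gamma> + real i))" for i
    using h \<gamma> by (intro integrable_times_powr) auto
  have int_F: "integrable lborel F"
    unfolding F_sum[abs_def] using int_i by (auto simp: set_integrable_def)
  have "integral\<^sup>L lborel F = (\<Sum>i<k. coeff p i * abel (\<gamma> + real i) g h)"
    unfolding F_sum[abs_def] abel_def set_lebesgue_integral_def using int_i
    by (subst Bochner_Integration.integral_sum) (auto simp: set_integrable_def)
  also have "\<dots> = 0"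
  proof (rule sum.neutral, rule ballI)
    fix i assume "i \<in> {..<k}"
    then have "\<gamma> + real i = \<beta> - real (k - 1 - i)" by (simp add: \<gamma>_def of_nat_diff)
    then show "coeff p i * abel (\<gamma> + real i) g h = 0" using moments[of "k - 1 - i"] k by simp
  qed
  finally have "integral\<^sup>L lborel F = 0" .
  moreover have F_nonneg: "F u \<ge> 0" for u
  proof (cases "0 < u \<and> u < h")
    case True
    then have "0 \<le> \<epsilon> * (g u * (\<Prod>t\<in>T. u - t)) * (h - u) powr \<gamma>" using nonneg by simp
    then show ?thesis using True by (simp add: F_def p mult_ac)
  qed (auto simp: F_def)
  ultimately have "AE u in lborel. F u = 0"
    using integral_nonneg_eq_0_iff_AE[OF int_F] by simp
  moreover have "AE u in lborel. u \<notin> {u. 0 < u \<and> u < h \<and> g u = 0}"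
    using Z(1) by (intro AE_not_in) (auto intro: finite_imp_null_set_lborel)
  \<comment> \<open>All roots of the polynomial are zeros of \<open>g\<close>, so \<open>F\<close>
    is nonzero on \<open>(0, h)\<close> off a finite set; being zero almost everywhere, it would
    make the interval null.\<close>
  ultimately have "AE u in lborel. u \<notin> {0<..<h}"
  proof eventually_elim
    case (elim u)
    show ?case
    proof
      assume u: "u \<in> {0<..<h}"
      then have "u \<notin> T" "g u \<noteq> 0" using elim(2) T by auto
      then have "F u \<noteq> 0" using u \<epsilon> finT by (auto simp: F_def p)
      then show False using elim(1) by simp
    qed
  qed
  then have "emeasure lborel {0<..<h} = 0" by (intro AE_iff_measurable[THEN iffD1]) auto
  then show False using h by simp
qed

end

text \<open>By linearity a combination of the \<open>I j\<close> is \<open>C\<close> times the Abel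
  integral of the same combination of the \<open>g j\<close>. The CT-property bounds the zeros of
  the latter, which rules out a zero of order \<open>m\<close> of the former.\<close>

lemma ECT_system_abel:
  fixes R :: ereal
  assumes CT: "CT_system n g (einterval 0 R)"
    and integrable: "\<And>j h. j < n \<Longrightarrow> h \<in> einterval 0 R \<Longrightarrow> set_integrable lborel {0<..<h} (g j)"
    and \<beta>: "\<beta> > real n - 2" "\<beta> > -1"
    and C: "C \<noteq> 0" and I: "\<And>j h. j < n \<Longrightarrow> h \<in> einterval 0 R \<Longrightarrow> I j h = C * abel \<beta> (g j) h"
  shows "ECT_system n I (einterval 0 R)"
proof -
  let ?S = "einterval 0 R"
  have open_S: "open ?S" by (rule open_einterval)
  have down: "x \<in> ?S" if "0 < x" "x \<le> h" "h \<in> ?S" for x h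
    using that by (auto simp: einterval_def zero_ereal_def intro: le_less_trans[of "ereal x" "ereal h" R])
  have pos: "0 < h" if "h \<in> ?S" for h using that by (auto simp: einterval_def zero_ereal_def)
  \<comment> \<open>Supplies the auxiliary end \<open>b\<close> of \<open>abel_density\<close>: a
    finite energy strictly beyond \<open>h\<close> up to which integrability is assumed.\<close>
  have larger: "\<exists>b\<in>?S. h < b" if "h \<in> ?S" for h
  proof -
    have "ereal h < R" using that by (simp add: einterval_def)
    then obtain b where "ereal h < ereal b" "ereal b < R" using ereal_dense2 by blast
    then show ?thesis using pos[OF that] by (intro bexI[of _ b]) (auto simp: einterval_def zero_ereal_def)
  qed
  have an: "ranalytic_at (g j) x" if "j < n" "x \<in> ?S" for j x
    using CT that real_analytic_on_open_iff[OF open_S] unfolding CT_system_def by blast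
  have dens: "abel_density (\<lambda>u. \<Sum>j<m. c j * g j u) b" if "m \<le> n" "b \<in> ?S" for m c b
  proof
    show "ranalytic_at (\<lambda>u. \<Sum>j<m. c j * g j u) x" if "0 < x" "x < b" for x
      using that \<open>m \<le> n\<close> down[OF _ _ \<open>b \<in> ?S\<close>, of x]
      by (intro ranalytic_at_sum ranalytic_at_mult[OF ranalytic_at_const] an) auto
    have "set_integrable lborel {0<..<b} (\<lambda>u. c j * g j u)" if "j < m" for j
      using that \<open>m \<le> n\<close> \<open>b \<in> ?S\<close> by (intro set_integrable_mult_right integrable) auto
    then show "set_integrable lborel {0<..<b} (\<lambda>u. \<Sum>j<m. c j * g j u)"
      unfolding set_integrable_def scaleR_sum_right by (intro Bochner_Integration.integrable_sum) auto
  qed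
  have dens1: "abel_density (g j) b" if "j < n" "b \<in> ?S" for j b
  proof
    show "ranalytic_at (g j) x" if "0 < x" "x < b" for x
      using that down[OF _ _ \<open>b \<in> ?S\<close>, of x] by (intro an \<open>j < n\<close>) auto
  qed (use integrable that in auto)
  have I_sum: "(\<Sum>j<m. c j * I j h) = C * abel \<beta> (\<lambda>u. \<Sum>j<m. c j * g j u) h" if m: "m \<le> n" and h: "h \<in> ?S" for m c h
  proof -
    obtain b where b: "b \<in> ?S" "h < b" using larger[OF h] by blast
    have int: "set_integrable lborel {0<..<h} (\<lambda>u. g j u * (h - u) powr \<beta>)" if "j < m" for j
      by (rule abel_density.integrable_times_powr[OF dens1 pos[OF h] b(2) \<beta>(2)]) (use that m b in auto)
    have "abel \<beta> (\<lambda>u. \<Sum>j<m. c j * g j u) h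
        = (LBINT u. (\<Sum>j<m. c j * (indicator {0<..<h} u *\<^sub>R (g j u * (h - u) powr \<beta>))))"
      unfolding abel_def set_lebesgue_integral_def
      by (intro Bochner_Integration.integral_cong) (auto simp: sum_distrib_left sum_distrib_right mult_ac)
    also have "\<dots> = (\<Sum>j<m. c j * abel \<beta> (g j) h)"
      unfolding abel_def set_lebesgue_integral_def using int
      by (subst Bochner_Integration.integral_sum) (auto simp: set_integrable_def)
    finally show ?thesis using m h by (simp add: I sum_distrib_left mult_ac)
  qed
  show ?thesis
  proof (rule ECT_systemI)
    show "is_interval ?S"
      unfolding is_interval_1 by (auto simp: einterval_def intro: le_less_trans less_le_trans ereal_less_eq(3)[THEN iffD2])
    show "open ?S" by (rule open_S)
    show "ranalytic_at (I j) x" if j: "j < n" and x: "x \<in> ?S" for j x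
    proof -
      obtain b where b: "b \<in> ?S" "x < b" using larger[OF x] by blast
      have "ranalytic_at (\<lambda>h. C * abel \<beta> (g j) h) x"
        using abel_density.ranalytic_at_abel[OF dens1[OF j b(1)] pos[OF x] b(2) \<beta>(2)]
        by (intro ranalytic_at_mult[OF ranalytic_at_const])
      then show ?thesis
        by (rule ranalytic_at_cong) (use I[OF j] eventually_nhds_in_open[OF open_S x] in \<open>auto elim!: eventually_mono\<close>)
    qed
    show "\<not> vanishes (\<lambda>x. \<Sum>j<m. c j * I j x) x m"
      if m: "m \<in> {1..n}" and c: "\<exists>j<m. c j \<noteq> 0" and x: "x \<in> ?S" for m c x
    proof
      assume v: "vanishes (\<lambda>x. \<Sum>j<m. c j * I j x) x m"
      obtain b where b: "b \<in> ?S" "x < b" using larger[OF x] by blast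
      define G where "G u = (\<Sum>j<m. c j * g j u)" for u
      interpret abel_density G b
        unfolding G_def[abs_def] by (rule dens) (use m b in auto)
      have Z: "finite {u\<in>?S. G u = 0}" "card {u\<in>?S. G u = 0} \<le> m - 1"
        using CT m c unfolding CT_system_def G_def by blast+
      have sub: "{u. 0 < u \<and> u < x \<and> G u = 0} \<subseteq> {u\<in>?S. G u = 0}" using down[OF _ _ x] by auto
      have "ranalytic_at (\<lambda>h. C * abel \<beta> G h) x"
        using ranalytic_at_abel[OF pos[OF x] b(2) \<beta>(2)] by (intro ranalytic_at_mult[OF ranalytic_at_const])
      moreover have "\<forall>\<^sub>F h in nhds x. (\<Sum>j<m. c j * I j h) = C * abel \<beta> G h"
        using eventually_nhds_in_open[OF open_S x] by eventually_elim (use I_sum m in \<open>simp add: G_def[abs_def]\<close>)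
      then have "vanishes (\<lambda>h. C * abel \<beta> G h) x m" using v by (rule vanishes_cong)
      ultimately have "vanishes (\<lambda>h. C * abel \<beta> G h * inverse C) x m"
        by (intro vanishes_mult[OF _ ranalytic_at_const])
      then have "vanishes (abel \<beta> G) x m" using C by (simp add: field_simps)
      moreover have "\<not> vanishes (abel \<beta> G) x m"
      proof (rule not_vanishes_abel)
        show "finite {u. 0 < u \<and> u < x \<and> G u = 0}" using Z(1) sub finite_subset by blast
        show "card {u. 0 < u \<and> u < x \<and> G u = 0} \<le> m - 1" using card_mono[OF Z(1) sub] Z(2) by simp
      qed (use pos[OF x] b m \<beta> in auto)
      ultimately show False by blast
    qed
  qed
qed

section \<open>Integrals along right arcs\<close>

lemma set_integrable_lborel_imp_absolutely_integrable_on: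
  fixes f :: "real \<Rightarrow> real"
  assumes "set_integrable lborel S f"
  shows "f absolutely_integrable_on S"
  using assms integrable_completion[of "\<lambda>x. indicator S x *\<^sub>R f x" lborel]
  unfolding set_integrable_def by (auto dest: borel_measurable_integrable)

text \<open>The change of variables takes place among Lebesgue measurable functions, so
  \<open>w\<close> may be singular at the ends. Continuity of the new integrand restores its Borel
  measurability, which is needed to return from the completed measure to
  \<open>lborel\<close>.\<close>

lemma set_integral_lborel_substitution:
  fixes w \<phi> \<phi>' :: "real \<Rightarrow> real"
  assumes S: "S \<in> sets borel"
    and deriv: "\<And>u. u \<in> S \<Longrightarrow> (\<phi> has_real_derivative \<phi>' u) (at u)" "\<And>u. u \<in> S \<Longrightarrow> \<phi>' u \<ge> 0"
    and inj: "inj_on \<phi> S"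
    and w: "set_integrable lborel (\<phi> ` S) w"
    and cont: "continuous_on S (\<lambda>u. \<phi>' u * w (\<phi> u))"
  shows "set_integrable lborel S (\<lambda>u. \<phi>' u * w (\<phi> u))"
    and "(LBINT u:S. \<phi>' u * w (\<phi> u)) = (LBINT x:\<phi> ` S. w x)"
proof -
  have "((\<lambda>u. \<bar>\<phi>' u\<bar> * w (\<phi> u)) absolutely_integrable_on S \<and>
      integral S (\<lambda>u. \<bar>\<phi>' u\<bar> * w (\<phi> u)) = integral (\<phi> ` S) w)"
    using S deriv(1) inj set_integrable_lborel_imp_absolutely_integrable_on[OF w]
    by (subst has_absolute_integral_change_of_variables_1') (auto intro: has_field_derivative_at_within)
  moreover have "integral S (\<lambda>u. \<bar>\<phi>' u\<bar> * w (\<phi> u)) = integral S (\<lambda>u. \<phi>' u * w (\<phi> u))"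
    by (rule Henstock_Kurzweil_Integration.integral_cong) (use deriv(2) in auto)
  moreover have "(\<lambda>u. \<bar>\<phi>' u\<bar> * w (\<phi> u)) absolutely_integrable_on S \<longleftrightarrow> (\<lambda>u. \<phi>' u * w (\<phi> u)) absolutely_integrable_on S"
    by (rule set_integrable_cong) (use deriv(2) in auto)
  ultimately have ai: "(\<lambda>u. \<phi>' u * w (\<phi> u)) absolutely_integrable_on S"
    and eq: "integral S (\<lambda>u. \<phi>' u * w (\<phi> u)) = integral (\<phi> ` S) w" by auto
  have "(\<lambda>u. indicator S u *\<^sub>R (\<phi>' u * w (\<phi> u))) \<in> borel_measurable borel"
    using borel_measurable_continuous_on_indicator[OF S cont] .
  then show int: "set_integrable lborel S (\<lambda>u. \<phi>' u * w (\<phi> u))"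
    using ai integrable_completion[of "\<lambda>u. indicator S u *\<^sub>R (\<phi>' u * w (\<phi> u))" lborel]
    unfolding set_integrable_def by auto
  show "(LBINT u:S. \<phi>' u * w (\<phi> u)) = (LBINT x:\<phi> ` S. w x)"
    using eq set_borel_integral_eq_integral(2)[OF int] set_borel_integral_eq_integral(2)[OF w] by simp
qed

text \<open>On the lower branch both the odd power of \<open>y\<close> and \<open>dx\<close> change
  sign, so both branches contribute equally, whence the factor 2. Inserting
  \<open>y = sqrt ((h - \<Psi> x) / \<kappa> x)\<close> produces the half-integer powers.\<close>

lemma right_arc_integral_eq:
  fixes \<kappa> \<Psi> f :: "real \<Rightarrow> real" and xr :: ereal and h :: real and s :: nat
  defines "a \<equiv> turning_point \<Psi> xr h"
    and "P \<equiv> \<lambda>x y. f x * y ^ (2 * s - 1)"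
    and "w \<equiv> \<lambda>x. f x / \<kappa> x powr ((2 * real s - 1) / 2) * (h - \<Psi> x) powr (real s - 1/2)"
  assumes a: "0 < a" and s: "0 < s"
    and pos: "\<And>x. 0 < x \<Longrightarrow> x < a \<Longrightarrow> \<kappa> x > 0 \<and> \<Psi> x < h"
    and conv: "right_arc_convergent \<kappa> \<Psi> xr h P"
  shows "set_integrable lborel {0<..<a} w"
    and "right_arc_integral \<kappa> \<Psi> xr h P = 2 * (LBINT x:{0<..<a}. w x)"
proof -
  define \<gamma> where "\<gamma> = right_arc_path \<kappa> \<Psi> xr h"
  define y where "y x = sqrt ((h - \<Psi> x) / \<kappa> x)" for x
  define F where "F t = P (fst (\<gamma> t)) (snd (\<gamma> t)) * deriv (\<lambda>t. fst (\<gamma> t)) t" for t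
  have \<gamma>: "\<gamma> t = (if t \<le> a then (t, y t) else (2 * a - t, - y (2 * a - t)))" for t
    unfolding \<gamma>_def right_arc_path_def Let_def y_def a_def by simp
  have w: "f x * y x ^ (2 * s - 1) = w x" if "0 < x" "x < a" for x
  proof -
    have p: "\<kappa> x > 0" "h - \<Psi> x > 0" using pos[OF that] by auto
    then have "((h - \<Psi> x) / \<kappa> x) powr (1/2) = y x"
      unfolding y_def by (intro powr_half_sqrt) simp
    then have "y x ^ (2 * s - 1) = (((h - \<Psi> x) / \<kappa> x) powr (1/2)) ^ (2 * s - 1)" by simp
    also have "\<dots> = ((h - \<Psi> x) / \<kappa> x) powr ((2 * real s - 1) / 2)"
      using p s by (subst powr_realpow[symmetric]) (auto simp: powr_powr of_nat_diff)
    also have "\<dots> = (h - \<Psi> x) powr ((2 * real s - 1) / 2) / \<kappa> x powr ((2 * real s - 1) / 2)"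
      using p by (simp add: powr_divide)
    also have eq: "(2 * real s - 1) / 2 = real s - 1/2" by simp
    finally show ?thesis by (simp add: w_def eq)
  qed
  have F1: "F t = w t" if "t \<in> {0<..<a}" for t
  proof -
    have "\<forall>\<^sub>F u in nhds t. fst (\<gamma> u) = u"
      using eventually_nhds_in_open[of "{0<..<a}" t] that by (auto elim!: eventually_mono simp: \<gamma>)
    then have "deriv (\<lambda>t. fst (\<gamma> t)) t = deriv (\<lambda>u. u) t" by (intro deriv_cong_ev refl)
    then show ?thesis using that w[of t] by (simp add: F_def \<gamma> P_def)
  qed
  have F2: "F t = w (2 * a - t)" if "t \<in> {a<..<2 * a}" for t
  proof -
    have "\<forall>\<^sub>F u in nhds t. fst (\<gamma> u) = 2 * a - u"
      using eventually_nhds_in_open[of "{a<..<2 * a}" t] that by (auto elim!: eventually_mono simp: \<gamma>)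
    then have "deriv (\<lambda>t. fst (\<gamma> t)) t = deriv (\<lambda>u. 2 * a - u) t" by (intro deriv_cong_ev refl)
    also have "\<dots> = -1" by (intro DERIV_imp_deriv) (auto intro!: derivative_eq_intros)
    finally have "F t = - (f (2 * a - t) * (- y (2 * a - t)) ^ (2 * s - 1))"
      using that by (simp add: F_def \<gamma> P_def)
    also have "(- y (2 * a - t)) ^ (2 * s - 1) = - (y (2 * a - t) ^ (2 * s - 1))"
      using s by (intro power_minus_odd) simp
    finally show ?thesis using that w[of "2 * a - t"] by simp
  qed
  have int: "set_integrable lborel {0<..<2 * a} F"
    using conv unfolding right_arc_convergent_def absolutely_convergent_dx_def F_def \<gamma>_def a_def .
  have int1: "set_integrable lborel {0<..<a} F" and int2: "set_integrable lborel {a<..<2 * a} F"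
    using a by (auto intro!: set_integrable_subset[OF int])
  show int_w: "set_integrable lborel {0<..<a} w"
    using int1 set_integrable_cong[OF refl refl, of "{0<..<a}" F w] F1 by blast
  have "right_arc_integral \<kappa> \<Psi> xr h P = (LBINT t:{0<..<2 * a}. F t)"
    unfolding right_arc_integral_def line_integral_dx_def F_def \<gamma>_def a_def ..
  \<comment> \<open>At \<open>t = a\<close> the abscissa turns back and its derivative does not
    exist; this single point is discarded.\<close>
  also have "\<dots> = (LBINT t:{0<..<a} \<union> {a<..<2 * a}. F t)"
  proof (rule set_integral_discrete_difference[where X = "{a}"])
    show "{0<..<2 * a} - ({0<..<a} \<union> {a<..<2 * a}) \<union> ({0<..<a} \<union> {a<..<2 * a} - {0<..<2 * a}) \<subseteq> {a}"
      using a by auto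
  qed auto
  also have "\<dots> = (LBINT t:{0<..<a}. F t) + (LBINT t:{a<..<2 * a}. F t)"
    by (rule set_integral_Un[OF _ int1 int2]) auto
  also have "(LBINT t:{0<..<a}. F t) = (LBINT x:{0<..<a}. w x)"
    by (rule set_lebesgue_integral_cong) (use F1 in auto)
  also have "(LBINT t:{a<..<2 * a}. F t) = (LBINT t:{a<..<2 * a}. w (2 * a - t))"
    by (rule set_lebesgue_integral_cong) (use F2 in auto)
  also have "\<dots> = (LBINT x:{0<..<a}. w x)"
  proof -
    have "(LBINT x:{0<..<a}. w x) = \<bar>-1\<bar> *\<^sub>R (LBINT t. indicator {0<..<a} (2 * a + (-1) * t) *\<^sub>R w (2 * a + (-1) * t))"
      unfolding set_lebesgue_integral_def by (rule lborel_integral_real_affine) simp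
    also have "\<dots> = (LBINT t:{a<..<2 * a}. w (2 * a - t))"
      unfolding set_lebesgue_integral_def by (auto intro!: Bochner_Integration.integral_cong simp: indicator_def)
    finally show ?thesis ..
  qed
  finally show "right_arc_integral \<kappa> \<Psi> xr h P = 2 * (LBINT x:{0<..<a}. w x)" by simp
qed

section \<open>The turning point as the analytic inverse of the potential\<close>

context piecewise_hamiltonian begin

lemma right_domain: "x \<in> einterval 0 xr \<Longrightarrow> 0 < x"
  by (simp add: einterval_def zero_ereal_def)

lemma right_domain_down: "0 < x \<Longrightarrow> x \<le> y \<Longrightarrow> y \<in> einterval 0 xr \<Longrightarrow> x \<in> einterval 0 xr"
  by (auto simp: einterval_def zero_ereal_def intro: le_less_trans[of "ereal x" "ereal y" xr])

lemma Psi1_analytic: "x \<in> einterval 0 xr \<Longrightarrow> ranalytic_at \<Psi>1 x"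
  by (rule real_analytic_on_interior[OF analytic_right(2) open_einterval[of 0 xr]])
     (auto simp: einterval_def zero_ereal_def)

lemma deriv_Psi1_pos: "x \<in> einterval 0 xr \<Longrightarrow> deriv \<Psi>1 x > 0"
  using right_pos[of x] right_domain[of x] by (simp add: zero_less_mult_iff)

text \<open>Strict monotonicity includes the end \<open>x = 0\<close>, where one-sided continuity
  takes the place of differentiability; this yields positivity of \<open>\<Psi>1\<close>
  inside.\<close>

lemma Psi1_less:
  assumes "0 \<le> x" "x < y" "y \<in> einterval 0 xr"
  shows "\<Psi>1 x < \<Psi>1 y"
proof (rule DERIV_pos_imp_increasing_open[OF assms(2)])
  show "\<exists>d. (\<Psi>1 has_real_derivative d) (at z) \<and> 0 < d" if "x < z" "z < y" for z
    using right_domain_down[of z y] that assms deriv_Psi1_pos ranalytic_at_has_deriv[OF Psi1_analytic]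
    by (intro exI[of _ "deriv \<Psi>1 z"]) auto
  show "continuous_on {x..y} \<Psi>1"
    using assms(1,3) by (intro continuous_on_subset[OF real_analytic_on_continuous_on[OF analytic_right(2)]])
      (auto simp: einterval_def intro: le_less_trans[of _ "ereal y" xr])
qed

text \<open>Since \<open>\<Psi>1\<close> tends to \<open>h0\<close> at \<open>xr\<close>, it exceeds
  \<open>h\<close> somewhere; the intermediate value theorem from \<open>\<Psi>1 0 = 0\<close> does
  the rest.\<close>

lemma Psi1_surj:
  assumes "h \<in> einterval 0 h0"
  shows "\<exists>x\<in>einterval 0 xr. \<Psi>1 x = h"
proof -
  have h: "0 < h" "ereal h < h0" using assms by (auto simp: einterval_def zero_ereal_def)
  have "\<forall>\<^sub>F x in at_left xr. ereal h < (ereal \<circ> \<Psi>1 \<circ> real_of_ereal) x"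
    using order_tendstoD(1)[OF energy_right h(2)] .
  then obtain e where e: "e < xr" "\<And>x. e < x \<Longrightarrow> x < xr \<Longrightarrow> ereal h < ereal (\<Psi>1 (real_of_ereal x))"
    unfolding eventually_at_left[OF xr_pos] by auto
  obtain y where "ereal y > max e 0" "ereal y < xr" using ereal_dense2[of "max e 0" xr] e(1) xr_pos by auto
  then have y: "y \<in> einterval 0 xr" "h < \<Psi>1 y" using e(2)[of "ereal y"] by (auto simp: einterval_def)
  have "continuous_on {0..y} \<Psi>1"
    using y(1) by (intro continuous_on_subset[OF real_analytic_on_continuous_on[OF analytic_right(2)]])
      (auto simp: einterval_def intro: le_less_trans[of _ "ereal y" xr])
  then obtain x where x: "0 \<le> x" "x \<le> y" "\<Psi>1 x = h"
    using IVT'[of \<Psi>1 0 h y] h y right_domain[OF y(1)] Psi_zero(1) by auto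
  then have "x \<noteq> 0" using h(1) Psi_zero(1) by auto
  then show ?thesis using x right_domain_down[of x y] y(1) by (intro bexI[of _ x]) auto
qed

lemma turning_point_Psi1:
  assumes "x \<in> einterval 0 xr"
  shows "turning_point \<Psi>1 xr (\<Psi>1 x) = x"
  unfolding turning_point_def
proof (rule the_equality)
  fix y assume "y \<in> einterval 0 xr \<and> \<Psi>1 y = \<Psi>1 x"
  then show "y = x" using assms Psi1_less[of x y] Psi1_less[of y x] right_domain
    by (cases x y rule: linorder_cases) (auto dest!: right_domain)
qed (use assms in simp)

lemma turning_point_properties:
  assumes "h \<in> einterval 0 h0"
  shows "turning_point \<Psi>1 xr h \<in> einterval 0 xr" "\<Psi>1 (turning_point \<Psi>1 xr h) = h"
  using Psi1_surj[OF assms] turning_point_Psi1 by auto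

lemma ranalytic_at_turning_point:
  assumes "h \<in> einterval 0 h0"
  shows "ranalytic_at (turning_point \<Psi>1 xr) h"
proof -
  define x where "x = turning_point \<Psi>1 xr h"
  have x: "x \<in> einterval 0 xr" "\<Psi>1 x = h" using turning_point_properties[OF assms] by (auto simp: x_def)
  have "ranalytic_at (turning_point \<Psi>1 xr) (\<Psi>1 x)"
  proof (rule ranalytic_at_inverse_function[where f = \<Psi>1])
    show "ranalytic_at \<Psi>1 x" by (rule Psi1_analytic[OF x(1)])
    show "deriv \<Psi>1 x \<noteq> 0" using deriv_Psi1_pos[OF x(1)] by simp
    show "\<forall>\<^sub>F y in nhds x. turning_point \<Psi>1 xr (\<Psi>1 y) = y"
      using eventually_nhds_in_open[OF open_einterval x(1)] by eventually_elim (rule turning_point_Psi1)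
  qed
  then show ?thesis by (simp add: x)
qed

text \<open>Differentiate \<open>\<Psi>1 (turning_point \<Psi>1 xr u) = u\<close>: the two
  derivatives have product 1.\<close>

lemma deriv_turning_point_pos:
  assumes "h \<in> einterval 0 h0"
  shows "deriv (turning_point \<Psi>1 xr) h > 0"
proof -
  define x where "x = turning_point \<Psi>1 xr h"
  have x: "x \<in> einterval 0 xr" "\<Psi>1 x = h" using turning_point_properties[OF assms] by (auto simp: x_def)
  have "((\<lambda>u. \<Psi>1 (turning_point \<Psi>1 xr u)) has_real_derivative
      deriv \<Psi>1 x * deriv (turning_point \<Psi>1 xr) h) (at h)"
    using ranalytic_at_has_deriv[OF Psi1_analytic[OF x(1)]]
      ranalytic_at_has_deriv[OF ranalytic_at_turning_point[OF assms]]
    unfolding x_def by (rule DERIV_chain2)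
  moreover have "\<forall>\<^sub>F u in nhds h. \<Psi>1 (turning_point \<Psi>1 xr u) = u"
    using eventually_nhds_in_open[OF open_einterval assms]
    by eventually_elim (rule turning_point_properties(2))
  ultimately have "((\<lambda>u. u) has_real_derivative deriv \<Psi>1 x * deriv (turning_point \<Psi>1 xr) h) (at h)"
    by (subst (asm) DERIV_cong_ev[OF refl _ refl]) auto
  then have "deriv \<Psi>1 x * deriv (turning_point \<Psi>1 xr) h = 1" using DERIV_unique DERIV_ident by blast
  then show ?thesis using deriv_Psi1_pos[OF x(1)] by (metis zero_less_mult_pos zero_less_one)
qed

lemma image_turning_point:
  assumes "h \<in> einterval 0 h0"
  shows "turning_point \<Psi>1 xr ` {0<..<h} = {0<..<turning_point \<Psi>1 xr h}"
proof -
  define a where "a = turning_point \<Psi>1 xr h"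
  have a: "a \<in> einterval 0 xr" "\<Psi>1 a = h" using turning_point_properties[OF assms] by (auto simp: a_def)
  have "x \<in> turning_point \<Psi>1 xr ` {0<..<h}" if "0 < x" "x < a" for x
  proof
    have x: "x \<in> einterval 0 xr" using right_domain_down[of x a] that a by simp
    show "x = turning_point \<Psi>1 xr (\<Psi>1 x)" using turning_point_Psi1[OF x] by simp
    show "\<Psi>1 x \<in> {0<..<h}" using Psi1_less[of 0 x] Psi1_less[of x a] that x a Psi_zero by simp
  qed
  moreover have "turning_point \<Psi>1 xr u \<in> {0<..<a}" if "0 < u" "u < h" for u
  proof -
    have "u \<in> einterval 0 h0" using that assms
      by (auto simp: einterval_def zero_ereal_def intro: less_trans[of "ereal u" "ereal h" h0])
    note u = turning_point_properties[OF this]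
    have "\<not> a \<le> turning_point \<Psi>1 xr u"
      using Psi1_less[of a "turning_point \<Psi>1 xr u"] u a that right_domain[OF a(1)] by (cases "a = turning_point \<Psi>1 xr u") auto
    then show ?thesis using right_domain[OF u(1)] by simp
  qed
  ultimately show ?thesis unfolding a_def[symmetric] by auto
qed

end

text \<open>An injective substitution maps zeros injectively to zeros, and a common factor without
  zeros adds none. Zeros are counted here without multiplicity, so no derivatives have to be
  compared.\<close>

lemma CT_system_compose:
  assumes CT: "CT_system n l T" and S: "open S" "open T"
    and \<phi>: "\<And>u. u \<in> S \<Longrightarrow> \<phi> u \<in> T" "inj_on \<phi> S" "\<And>u. u \<in> S \<Longrightarrow> ranalytic_at \<phi> u"
    and q: "\<And>u. u \<in> S \<Longrightarrow> q u \<noteq> 0" "\<And>u. u \<in> S \<Longrightarrow> ranalytic_at q u"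
  shows "CT_system n (\<lambda>j u. q u * l j (\<phi> u)) S"
  unfolding CT_system_def
proof (intro conjI allI impI ballI)
  show "real_analytic_on (\<lambda>u. q u * l j (\<phi> u)) S" if "j < n" for j
    unfolding real_analytic_on_open_iff[OF S(1)]
  proof
    fix u assume u: "u \<in> S"
    have "ranalytic_at (l j) (\<phi> u)"
      using CT that \<phi>(1)[OF u] real_analytic_on_open_iff[OF S(2)] unfolding CT_system_def by blast
    then show "ranalytic_at (\<lambda>u. q u * l j (\<phi> u)) u"
      by (rule ranalytic_at_mult[OF q(2)[OF u] ranalytic_at_compose[OF \<phi>(3)[OF u]]])
  qed
  fix k and c :: "nat \<Rightarrow> real" assume k: "k \<in> {1..n}" and c: "\<exists>j<k. c j \<noteq> 0"
  let ?A = "{u \<in> S. (\<Sum>j<k. c j * (q u * l j (\<phi> u))) = 0}" and ?B = "{x \<in> T. (\<Sum>j<k. c j * l j x) = 0}"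
  have B: "finite ?B" "card ?B \<le> k - 1" using CT k c unfolding CT_system_def by blast+
  have "(\<Sum>j<k. c j * (q u * l j (\<phi> u))) = q u * (\<Sum>j<k. c j * l j (\<phi> u))" for u
    by (simp add: sum_distrib_left mult_ac)
  then have sub: "\<phi> ` ?A \<subseteq> ?B" using \<phi>(1) q(1) by auto
  have inj: "inj_on \<phi> ?A" using \<phi>(2) by (rule inj_on_subset) auto
  show "finite ?A" using inj_on_finite[OF inj sub B(1)] .
  show "card ?A \<le> k - 1" using card_inj_on_le[OF inj sub B(1)] B(2) by simp
qed

theorem theorem1p2:
  fixes n s :: nat
    and \<chi>1 \<Psi>1 \<chi>2 \<Psi>2 :: "real \<Rightarrow> real" and xl xr h0 :: ereal
    and f :: "nat \<Rightarrow> real \<Rightarrow> real"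
  defines "I \<equiv> \<lambda>i h. right_arc_integral \<chi>1 \<Psi>1 xr h (\<lambda>x y. f i x * y ^ (2 * s - 1))"
    and "l \<equiv> \<lambda>i x. f i x / \<chi>1 x powr ((2 * real s - 1) / 2)"
  assumes "0 < n" and "0 < s"
    and "piecewise_hamiltonian \<chi>1 \<Psi>1 \<chi>2 \<Psi>2 xl xr h0"
    and "\<exists>c. \<forall>x\<in>einterval xl xr - {0}.
           (involution \<Psi>1 \<Psi>2 xl xr has_real_derivative c) (at x)"
    and "\<forall>i<n. real_analytic_on (f i) (einterval 0 xr)"
    and "\<forall>i<n. \<forall>h\<in>einterval 0 h0.
           right_arc_convergent \<chi>1 \<Psi>1 xr h (\<lambda>x y. f i x * y ^ (2 * s - 1))"
    and "CT_system n l (einterval 0 xr)"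
    and "int s > int n - 2"
  shows "ECT_system n I (einterval 0 h0)"
proof -
  interpret piecewise_hamiltonian \<chi>1 \<Psi>1 \<chi>2 \<Psi>2 xl xr h0 by fact
  let ?H = "einterval 0 h0" and ?X = "einterval 0 xr"
  define \<phi> where "\<phi> = turning_point \<Psi>1 xr"
  define \<beta> where "\<beta> = real s - 1/2"
  \<comment> \<open>With \<open>x = \<phi> u\<close>, \<open>l j x dx\<close> becomes
    \<open>g j u du\<close>. The Jacobian is positive and common to all \<open>j\<close>, so the
    CT-property carries over.\<close>
  define g where "g j u = deriv \<phi> u * l j (\<phi> u)" for j u
  have \<phi>: "\<phi> u \<in> ?X" "\<Psi>1 (\<phi> u) = u" "ranalytic_at \<phi> u" "deriv \<phi> u > 0" if "u \<in> ?H" for u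
    using turning_point_properties ranalytic_at_turning_point deriv_turning_point_pos that by (auto simp: \<phi>_def)
  have inj: "inj_on \<phi> ?H" by (rule inj_on_inverseI[of _ \<Psi>1]) (rule \<phi>(2))
  have down: "u \<in> ?H" if "0 < u" "u \<le> h" "h \<in> ?H" for u h
    using that by (auto simp: einterval_def zero_ereal_def intro: le_less_trans[of "ereal u" "ereal h" h0])
  have CT: "CT_system n g ?H"
    unfolding g_def[abs_def]
    using \<open>CT_system n l ?X\<close> inj \<phi> by (intro CT_system_compose[where T = ?X] ranalytic_at_deriv open_einterval) (auto dest: \<phi>(4))
  have g_an: "ranalytic_at (g j) u" if "j < n" "u \<in> ?H" for j u
    using CT that real_analytic_on_open_iff[OF open_einterval] unfolding CT_system_def by blast
  have arc: "set_integrable lborel {0<..<h} (\<lambda>u. g j u * (h - u) powr \<beta>) \<and> I j h = 2 * abel \<beta> (g j) h"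
    if j: "j < n" and h: "h \<in> ?H" for j h
  proof -
    define w where "w x = l j x * (h - \<Psi>1 x) powr \<beta>" for x
    have a: "0 < \<phi> h" using right_domain[OF \<phi>(1)[OF h]] .
    have pos: "\<chi>1 x > 0 \<and> \<Psi>1 x < h" if "0 < x" "x < \<phi> h" for x
      using right_pos[OF right_domain_down[OF that(1) less_imp_le[OF that(2)] \<phi>(1)[OF h]]]
        Psi1_less[of x "\<phi> h"] that \<phi>[OF h] by auto
    have w: "set_integrable lborel {0<..<\<phi> h} w" "I j h = 2 * (LBINT x:{0<..<\<phi> h}. w x)"
      using right_arc_integral_eq[of \<Psi>1 xr h s \<chi>1 "f j"] a \<open>0 < s\<close> pos j h
        \<open>\<forall>i<n. \<forall>h\<in>?H. right_arc_convergent \<chi>1 \<Psi>1 xr h (\<lambda>x y. f i x * y ^ (2 * s - 1))\<close>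
      unfolding I_def l_def w_def[abs_def] \<beta>_def \<phi>_def by blast+
    have sub: "{0<..<h} \<subseteq> ?H" using down[OF _ _ h] by auto
    have img: "\<phi> ` {0<..<h} = {0<..<\<phi> h}" using image_turning_point[OF h] by (simp add: \<phi>_def)
    have integrand: "deriv \<phi> u * w (\<phi> u) = g j u * (h - u) powr \<beta>" if "u \<in> {0<..<h}" for u
      using \<phi>(2)[of u] that sub by (auto simp: w_def g_def)
    have "continuous_on {0<..<h} (\<lambda>u. g j u * (h - u) powr \<beta>)"
      using sub by (intro continuous_intros continuous_at_imp_continuous_on ballI ranalytic_at_isCont g_an j) auto
    then have cont: "continuous_on {0<..<h} (\<lambda>u. deriv \<phi> u * w (\<phi> u))"
      by (rule continuous_on_eq) (use integrand in auto)
    have w': "set_integrable lborel (\<phi> ` {0<..<h}) w" using w(1) img by simp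
    have d: "(\<phi> has_real_derivative deriv \<phi> u) (at u)" "deriv \<phi> u \<ge> 0" if "u \<in> {0<..<h}" for u
      using ranalytic_at_has_deriv[OF \<phi>(3)] \<phi>(4)[of u] that sub by auto
    have inj': "inj_on \<phi> {0<..<h}" using inj sub by (rule inj_on_subset)
    have "set_integrable lborel {0<..<h} (\<lambda>u. deriv \<phi> u * w (\<phi> u))"
      and "(LBINT u:{0<..<h}. deriv \<phi> u * w (\<phi> u)) = (LBINT x:{0<..<\<phi> h}. w x)"
      using set_integral_lborel_substitution[OF _ d inj' w' cont] img by auto
    moreover have "set_integrable lborel {0<..<h} (\<lambda>u. deriv \<phi> u * w (\<phi> u))
        \<longleftrightarrow> set_integrable lborel {0<..<h} (\<lambda>u. g j u * (h - u) powr \<beta>)"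
      by (rule set_integrable_cong) (use integrand in auto)
    moreover have "(LBINT u:{0<..<h}. deriv \<phi> u * w (\<phi> u)) = abel \<beta> (g j) h"
      unfolding abel_def by (rule set_lebesgue_integral_cong) (use integrand in auto)
    ultimately show ?thesis using w(2) by simp
  qed
  show ?thesis
  proof (rule ECT_system_abel[where g = g and \<beta> = \<beta> and C = 2])
    show "CT_system n g ?H" by (rule CT)
    show "I j h = 2 * abel \<beta> (g j) h" if "j < n" "h \<in> ?H" for j h using arc[OF that] by blast
    \<comment> \<open>For integers, \<open>s > n - 2\<close> means \<open>s \<ge> n - 1\<close>,
      hence \<open>\<beta> \<ge> n - 3/2\<close>; the half gained here is what makes the inequality
      strict.\<close>
    show "\<beta> > real n - 2" "\<beta> > -1" using \<open>int s > int n - 2\<close> \<open>0 < s\<close> by (auto simp: \<beta>_def)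
    show "set_integrable lborel {0<..<h} (g j)" if j: "j < n" and h: "h \<in> ?H" for j h
    proof -
      have "ereal h < h0" using h by (simp add: einterval_def)
      \<comment> \<open>Convergence at energy \<open>h\<close> controls \<open>g j\<close> only
        against a weight that vanishes at \<open>u = h\<close>. At a larger energy \<open>k\<close>
        the weight \<open>(k - u) powr \<beta>\<close> is at least
        \<open>(k - h) powr \<beta>\<close> on \<open>(0, h)\<close>, so it can be divided
        out.\<close>
      then obtain k where k: "h < k" "ereal k < h0" using ereal_dense2[of "ereal h" h0] by auto
      have h_pos: "0 < h" using h by (simp add: einterval_def zero_ereal_def)
      have kH: "k \<in> ?H" using k h_pos by (simp add: einterval_def zero_ereal_def)
      have "set_integrable lborel {0<..<h} (\<lambda>u. (k - h) powr (- \<beta>) * (g j u * (k - u) powr \<beta>))"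
        by (rule set_integrable_mult_right, rule set_integrable_subset[OF conjunct1[OF arc[OF j kH]]]) (use k in auto)
      then show ?thesis
      proof (rule set_integrable_bound)
        have "continuous_on {0<..<h} (g j)"
          using down[OF _ _ h] by (intro continuous_at_imp_continuous_on ballI ranalytic_at_isCont g_an j) auto
        then show "set_borel_measurable lborel {0<..<h} (g j)"
          unfolding set_borel_measurable_def
          using borel_measurable_continuous_on_indicator[of "{0<..<h}" "g j"] by simp
        have "\<bar>g j u\<bar> \<le> (k - h) powr (- \<beta>) * (\<bar>g j u\<bar> * (k - u) powr \<beta>)" if "0 < u" "u < h" for u
        proof -
          have "(k - h) powr \<beta> \<le> (k - u) powr \<beta>"
            using that k \<open>0 < s\<close> by (intro powr_mono2) (auto simp: \<beta>_def)
          then have "1 \<le> (k - h) powr (- \<beta>) * (k - u) powr \<beta>"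
            using k by (simp add: powr_minus divide_simps)
          from mult_left_mono[OF this, of "\<bar>g j u\<bar>"] show ?thesis by (simp add: mult_ac)
        qed
        then show "AE u in lborel. u \<in> {0<..<h} \<longrightarrow> norm (g j u) \<le> norm ((k - h) powr (- \<beta>) * (g j u * (k - u) powr \<beta>))"
          by (intro AE_I2) (auto simp: abs_mult)
      qed
    qed
  qed simp
qed

end
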